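(* For an elliptic zeta function $\mathcal{Z}$ (of some weight $k\in\mathbb{Z}$) such that $\Psi_{\Lambda_\tau}$ is not identically zero as a function of $\tau\in\mathbb{H}$, consider $$\mathcal{Z}\longmapsto \frac{\Phi_{\Lambda_\tau}}{\Psi_{\Lambda_\tau}}.$$ This is a well-defined map from the set of such elliptic zeta functions to the space $M_2(\mathrm{SL}_2(\mathbb{Z}))$ of weight 2 meromorphic modular forms, and this map is surjective.
   Context: $\mathbb{H}$ is the upper half-plane and $\Lambda_\tau=\mathbb{Z}+\tau\mathbb{Z}$ for $\tau\in\mathbb{H}$. Lattices in $\mathbb{C}$ are written $\Lambda=\omega_1\mathbb{Z}+\omega_2\mathbb{Z}$ with $\Im(\omega_2/\omega_1)>0$; $\mathcal{L}$ is the set of all lattices. $M_2(\mathrm{SL}_2(\mathbb{Z}))$ is the space of meromorphic functions $f$ on $\mathbb{H}$ with $f\left(\frac{a\tau+b}{c\tau+d}\right)=(c\tau+d)^2f(\tau)$ for all $\begin{bmatrix}a&b\\c&d\end{bmatrix}\in\mathrm{SL}_2(\mathbb{Z})$ (no condition at the cusp is imposed here). Weierstrass zeta function: $\zeta(\Lambda,z)=\frac1z+\sum_{\omega\in\Lambda,\,\omega\ne0}\left(\frac{1}{z-\omega}+\frac1\omega+\frac{z}{\omega^2}\right)$; its quasi-period map $\eta_\Lambda$ is defined by $\zeta(\Lambda,z+\omega)=\zeta(\Lambda,z)+\eta_\Lambda(\omega)$, $\omega\in\Lambda$. An elliptic zeta function of weight $k\in\mathbb{Z}$ is a map $\mathcal{Z}:\mathcal{L}\times\mathbb{C}\to\mathbb{C}\cup\{\infty\}$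 such that: (1) for each $\Lambda$, $\mathcal{Z}(\Lambda,\cdot)$ is meromorphic on $\mathbb{C}$ and quasi-periodic: $\mathcal{Z}(\Lambda,z+\omega)=\mathcal{Z}(\Lambda,z)+H_\Lambda(\omega)$ for $z\in\mathbb{C}$, $\omega\in\Lambda$, with $H_\Lambda(\omega)$ independent of $z$; (2) $\mathcal{Z}(\alpha\Lambda,\alpha z)=\alpha^k\mathcal{Z}(\Lambda,z)$ for $\alpha\in\mathbb{C}^*$, $z\in\mathbb{C}$; (3) $\tau\mapsto H_{\Lambda_\tau}(\tau)$ and $\tau\mapsto H_{\Lambda_\tau}(1)$ are meromorphic on $\mathbb{H}$. Convention: since poles in $\tau$ are allowed in (3), there may be a closed discrete $\mathrm{SL}_2(\mathbb{Z})$-invariant set $S\subset\mathbb{H}$ such that (1), (2) are required only for lattices $\alpha\Lambda_\tau$ with $\alpha\in\mathbb{C}^*$, $\tau\notin S$; the functions in (3) are then holomorphic on $\mathbb{H}\setminus S$ with at most poles at points of $S$. All identities between lattice functions are understood away from such exceptional lattices. For such $\mathcal{Z}$ and $\Lambda=\omega_1\mathbb{Z}+\omega_2\mathbb{Z}$, the quantities $\Phi_\Lambda,\Psi_\Lambda$ are defined by $$\begin{bmatrix}\Phi_\Lambda\\ \Psi_\Lambda\end{bmatrix}=\begin{bmatrix}\omega_2&\eta_\Lambda(\omega_2)\\ \omega_1&\eta_\Lambda(\omega_1)\end{bmatrix}^{-1}\begin{bmatrix}H_\Lambda(\omega_2)\\ H_\Lambda(\omega_1)\end{bmatrix}$$ (the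 matrix is invertible and the result is independent of the basis); equivalently, $H_\Lambda(\omega)=\Phi_\Lambda\omega+\Psi_\Lambda\eta_\Lambda(\omega)$ for all $\omega\in\Lambda$, and $\mathcal{Z}(\Lambda,z)=\Phi_\Lambda z+\Psi_\Lambda\zeta(\Lambda,z)+E_\Lambda(z)$ with $E_\Lambda$ a $\Lambda$-elliptic function. *)

theory Defs
  imports "HOL-Complex_Analysis.Complex_Analysis" "HOL-Library.FuncSet"
begin

definition upper_half_plane :: "complex set" where
  "upper_half_plane = {\<tau>. Im \<tau> > 0}"

definition lattice_gen :: "complex \<Rightarrow> complex \<Rightarrow> complex set" where
  "lattice_gen \<omega>1 \<omega>2 = {of_int m * \<omega>1 + of_int n * \<omega>2 | m n. True}"

abbreviation lattice_of :: "complex \<Rightarrow> complex set" where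
  "lattice_of \<tau> \<equiv> lattice_gen 1 \<tau>"

definition oriented_basis :: "complex set \<Rightarrow> complex \<Rightarrow> complex \<Rightarrow> bool" where
  "oriented_basis \<Lambda> \<omega>1 \<omega>2 \<longleftrightarrow> Im (\<omega>2 / \<omega>1) > 0 \<and> \<Lambda> = lattice_gen \<omega>1 \<omega>2"

definition mobius :: "int \<Rightarrow> int \<Rightarrow> int \<Rightarrow> int \<Rightarrow> complex \<Rightarrow> complex" where
  "mobius a b c d \<tau> = (of_int a * \<tau> + of_int b) / (of_int c * \<tau> + of_int d)"

text \<open>
  Meromorphic functions are represented throughout by the library's normal form
  \<^const>\<open>nicely_meromorphic_on\<close>: the value \<open>\<infinity>\<close> at a pole is encoded by \<^const>\<open>is_pole\<close> together
  with the dummy value 0. Homogeneity laws \<open>f (A z) = c * f z\<close> with \<open>c \<noteq> 0\<close> can then be stated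
  at all points, poles included, whereas \<open>f (z + \<omega>) = f z + h\<close> can only be stated away from poles.
  Functions on the upper half-plane are made unique by \<^const>\<open>extensional\<close>.
\<close>

definition weight2_meromorphic_modular_forms :: "(complex \<Rightarrow> complex) set" where
  "weight2_meromorphic_modular_forms =
     {f \<in> extensional upper_half_plane.
        f nicely_meromorphic_on upper_half_plane \<and>
        (\<forall>a b c d. a * d - b * c = 1 \<longrightarrow>
           (\<forall>\<tau>\<in>upper_half_plane.
              f (mobius a b c d \<tau>) = (of_int c * \<tau> + of_int d)\<^sup>2 * f \<tau>))}"

definition is_quasi_period :: "(complex \<Rightarrow> complex) \<Rightarrow> complex \<Rightarrow> complex \<Rightarrow> bool" where
  "is_quasi_period f \<omega> h \<longleftrightarrow> (\<forall>z. \<not> is_pole f z \<longrightarrow> f (z + \<omega>) = f z + h)"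

definition quasi_period :: "(complex \<Rightarrow> complex) \<Rightarrow> complex \<Rightarrow> complex" where
  "quasi_period f \<omega> = (THE h. is_quasi_period f \<omega> h)"

text \<open>
  The values of the following function at points of \<open>\<Lambda>\<close>, which are its poles, are
  meaningless (they come from division by zero) and are never used.
\<close>

definition weierstrass_zeta :: "complex set \<Rightarrow> complex \<Rightarrow> complex" where
  "weierstrass_zeta \<Lambda> z =
     1 / z + (\<Sum>\<^sub>\<infinity>\<omega>\<in>\<Lambda> - {0}. 1 / (z - \<omega>) + 1 / \<omega> + z / \<omega>\<^sup>2)"

definition weierstrass_eta :: "complex set \<Rightarrow> complex \<Rightarrow> complex" where
  "weierstrass_eta \<Lambda> = quasi_period (weierstrass_zeta \<Lambda>)"

definition exceptional_set :: "complex set \<Rightarrow> bool" where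
  "exceptional_set S \<longleftrightarrow>
     closedin (top_of_set upper_half_plane) S \<and> discrete S \<and>
     (\<forall>a b c d. a * d - b * c = 1 \<longrightarrow> (\<forall>\<tau>\<in>S. mobius a b c d \<tau> \<in> S))"

definition regular_lattices :: "complex set \<Rightarrow> complex set set" where
  "regular_lattices S =
     {(*) \<alpha> ` lattice_of \<tau> | \<alpha> \<tau>. \<alpha> \<noteq> 0 \<and> \<tau> \<in> upper_half_plane - S}"

text \<open>
  \<open>\<Z> \<Lambda>\<close> is unconstrained on lattices that are exceptional with respect to \<open>S\<close>; in the last
  two conditions, meromorphy adds to holomorphy that the points of \<open>S\<close> are at most poles.
\<close>

definition elliptic_zeta ::
    "int \<Rightarrow> complex set \<Rightarrow> (complex set \<Rightarrow> complex \<Rightarrow> complex) \<Rightarrow> bool" where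
  "elliptic_zeta k S \<Z> \<longleftrightarrow>
     exceptional_set S \<and>
     (\<forall>\<Lambda>\<in>regular_lattices S.
        \<Z> \<Lambda> nicely_meromorphic_on UNIV \<and>
        (\<forall>\<omega>\<in>\<Lambda>. \<exists>h. is_quasi_period (\<Z> \<Lambda>) \<omega> h) \<and>
        (\<forall>\<alpha> z. \<alpha> \<noteq> 0 \<longrightarrow> \<Z> ((*) \<alpha> ` \<Lambda>) (\<alpha> * z) = \<alpha> powi k * \<Z> \<Lambda> z)) \<and>
     (\<forall>H \<in> {\<lambda>\<tau>. quasi_period (\<Z> (lattice_of \<tau>)) \<tau>,
            \<lambda>\<tau>. quasi_period (\<Z> (lattice_of \<tau>)) 1}.
        H holomorphic_on (upper_half_plane - S) \<and> H meromorphic_on upper_half_plane)"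

definition PhiPsi_basis ::
    "(complex set \<Rightarrow> complex \<Rightarrow> complex) \<Rightarrow> complex set \<Rightarrow> complex \<Rightarrow> complex \<Rightarrow> complex ^ 2" where
  "PhiPsi_basis \<Z> \<Lambda> \<omega>1 \<omega>2 =
     matrix_inv (vector [vector [\<omega>2, weierstrass_eta \<Lambda> \<omega>2],
                         vector [\<omega>1, weierstrass_eta \<Lambda> \<omega>1]] :: complex ^ 2 ^ 2)
     *v vector [quasi_period (\<Z> \<Lambda>) \<omega>2, quasi_period (\<Z> \<Lambda>) \<omega>1]"

text \<open>The value common to all oriented bases of \<open>\<Lambda>\<close>; the components are \<open>\<Phi>\<close> and \<open>\<Psi>\<close>.\<close>

definition PhiPsi ::
    "(complex set \<Rightarrow> complex \<Rightarrow> complex) \<Rightarrow> complex set \<Rightarrow> complex ^ 2" where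
  "PhiPsi \<Z> \<Lambda> = (THE v. \<forall>\<omega>1 \<omega>2. oriented_basis \<Lambda> \<omega>1 \<omega>2 \<longrightarrow> v = PhiPsi_basis \<Z> \<Lambda> \<omega>1 \<omega>2)"

definition Phi :: "(complex set \<Rightarrow> complex \<Rightarrow> complex) \<Rightarrow> complex set \<Rightarrow> complex" where
  "Phi \<Z> \<Lambda> = PhiPsi \<Z> \<Lambda> $ 1"

definition Psi :: "(complex set \<Rightarrow> complex \<Rightarrow> complex) \<Rightarrow> complex set \<Rightarrow> complex" where
  "Psi \<Z> \<Lambda> = PhiPsi \<Z> \<Lambda> $ 2"

text \<open>
  ``\<open>\<Psi>\<close> is not identically zero'' has to be read off the exceptional set, where \<open>\<Psi>\<close> has
  no meaning.
\<close>

definition nondegenerate_elliptic_zetas :: "(complex set \<Rightarrow> complex \<Rightarrow> complex) set" where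
  "nondegenerate_elliptic_zetas =
     {\<Z>. \<exists>k S. elliptic_zeta k S \<Z> \<and>
            (\<exists>\<tau>\<in>upper_half_plane - S. Psi \<Z> (lattice_of \<tau>) \<noteq> 0)}"

definition Phi_over_Psi ::
    "(complex set \<Rightarrow> complex \<Rightarrow> complex) \<Rightarrow> complex \<Rightarrow> complex" where
  "Phi_over_Psi \<Z> \<tau> = Phi \<Z> (lattice_of \<tau>) / Psi \<Z> (lattice_of \<tau>)"

text \<open>
  The pointwise quotient is arbitrary at exceptional points and at zeros of \<open>\<Psi>\<close>;
  \<^const>\<open>remove_sings\<close> passes to the meromorphic function that it represents.
\<close>

definition modular_quotient ::
    "(complex set \<Rightarrow> complex \<Rightarrow> complex) \<Rightarrow> complex \<Rightarrow> complex" where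
  "modular_quotient \<Z> = restrict (remove_sings (Phi_over_Psi \<Z>)) upper_half_plane"

end

theory Submission
  imports Defs
begin

text \<open>
  Solving \<open>H \<omega> = \<Phi> \<omega> + \<Psi> \<eta> \<omega>\<close> at the periods \<open>1\<close> and \<open>\<tau>\<close> gives
  \<open>\<Phi> / \<Psi> = (\<eta> 1 * H \<tau> - \<eta> \<tau> * H 1) / (\<tau> * H 1 - H \<tau>)\<close>. Since \<open>\<eta> \<omega> = 2 \<zeta> (\<omega> / 2)\<close>, locally uniform
  convergence of the series of \<open>\<zeta>\<close> in \<open>\<tau>\<close> makes this a meromorphic function of \<open>\<tau>\<close>. Under
  \<open>\<Lambda> \<mapsto> \<alpha> \<Lambda>\<close> the quasi-periods \<open>H\<close> and \<open>\<eta>\<close> scale by \<open>\<alpha>\<^sup>k\<close> and \<open>1 / \<alpha>\<close>, so \<open>\<Phi> / \<Psi>\<close> is a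
  lattice function of weight \<open>- 2\<close>, that is, a modular form of weight \<open>2\<close>. Conversely, a form \<open>f\<close>
  extends to a lattice function \<open>F\<close> with \<open>F (\<alpha> \<Lambda>) = F \<Lambda> / \<alpha>\<^sup>2\<close>, and \<open>F \<Lambda> * z + \<zeta> \<Lambda> z\<close> is an elliptic
  zeta function of weight \<open>- 1\<close> with \<open>\<Phi> = F\<close> and \<open>\<Psi> = 1\<close>.
\<close>

section \<open>Lattice sums\<close>

text \<open>The definitions work lattice by lattice, while the claim concerns meromorphic functions
  of \<tau>. Since the lattice moves with \<tau>, its sums have to be re-indexed by pairs of
  integers and bounded uniformly for \<tau> near a given point. Half-periods are good evaluation
  points because their distance to the lattice point with index \<open>(m, n)\<close> grows linearly
  in the index. Exceptional points are isolated, and both meromorphy and \<open>remove_sings\<close>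
  depend only on punctured neighbourhoods, so laws proved off the exceptional set extend across it.

  Solving for \<Phi> and \<Psi> requires a nonzero determinant for every oriented basis. The
  classical proof integrates zeta around a period parallelogram. Here a vanishing determinant is
  refuted without contour integrals: it would yield an odd elliptic function with one simple pole
  per cell, and the product with its half-period translate would be entire and bounded.\<close>

lemma holomorphic_on_infsum:
  fixes g :: "'i \<Rightarrow> complex \<Rightarrow> complex"
  assumes hol: "\<And>i. i \<in> I \<Longrightarrow> g i holomorphic_on U" and "open U"
    and maj: "\<And>x. x \<in> U \<Longrightarrow> \<exists>M F r. r > 0 \<and> finite F \<and> M summable_on I \<and>
               (\<forall>i\<in>I - F. \<forall>y\<in>ball x r. norm (g i y) \<le> M i)"
  shows "(\<lambda>x. \<Sum>\<^sub>\<infinity>i\<in>I. g i x) holomorphic_on U"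
proof (rule holomorphic_onI)
  fix x assume x: "x \<in> U"
  obtain M F r where r: "r > 0" "finite F" "M summable_on I"
    and bnd: "\<And>i y. i \<in> I - F \<Longrightarrow> y \<in> ball x r \<Longrightarrow> norm (g i y) \<le> M i"
    using maj[OF x] by blast
  obtain e where e: "e > 0" "ball x e \<subseteq> U"
    using \<open>open U\<close> x by (meson openE)
  define d where "d = min (r / 2) (e / 2)"
  have d: "d > 0" "cball x d \<subseteq> ball x r" "cball x d \<subseteq> U"
    using r e by (auto simp: d_def subset_iff)
  have sumM: "M summable_on (I - F)"
    using r(3) by (rule summable_on_subset_banach) auto
  have ul: "uniform_limit (cball x d) (\<lambda>X y. \<Sum>i\<in>X. g i y) (\<lambda>y. \<Sum>\<^sub>\<infinity>i\<in>I-F. g i y)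
              (finite_subsets_at_top (I - F))"
    by (rule Weierstrass_m_test_general[OF _ sumM]) (use bnd d in blast)
  have hol': "(\<lambda>y. \<Sum>i\<in>X. g i y) holomorphic_on U" if "X \<subseteq> I" for X
    using hol that by (intro holomorphic_on_sum) auto
  have ev: "\<forall>\<^sub>F X in finite_subsets_at_top (I - F).
          continuous_on (cball x d) (\<lambda>y. \<Sum>i\<in>X. g i y) \<and> (\<lambda>y. \<Sum>i\<in>X. g i y) holomorphic_on ball x d"
  proof (rule eventually_finite_subsets_at_top_weakI)
    fix X assume "finite X" "X \<subseteq> I - F"
    then have "(\<lambda>y. \<Sum>i\<in>X. g i y) holomorphic_on U"
      using hol' by blast
    then show "continuous_on (cball x d) (\<lambda>y. \<Sum>i\<in>X. g i y) \<and> (\<lambda>y. \<Sum>i\<in>X. g i y) holomorphic_on ball x d"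
      by (meson ball_subset_cball d(3) holomorphic_on_imp_continuous_on holomorphic_on_subset
          continuous_on_subset order_trans)
  qed
  have hol1: "(\<lambda>y. \<Sum>\<^sub>\<infinity>i\<in>I-F. g i y) holomorphic_on ball x d"
    by (rule holomorphic_uniform_limit[OF ev ul]) auto
  \<comment> \<open>Finitely many terms may escape the majorant. For zeta these belong to the
    lattice points of small norm, whose terms are holomorphic one by one.\<close>
  have hol2: "(\<lambda>y. \<Sum>i\<in>I \<inter> F. g i y) holomorphic_on ball x d"
    using hol'[of "I \<inter> F"] by (rule holomorphic_on_subset) (use d in auto)
  have eq: "(\<Sum>\<^sub>\<infinity>i\<in>I. g i y) = (\<Sum>i\<in>I \<inter> F. g i y) + (\<Sum>\<^sub>\<infinity>i\<in>I-F. g i y)" if y: "y \<in> ball x d" for y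
  proof -
    have "y \<in> ball x r"
      using y d(2) ball_subset_cball by blast
    then have "(\<lambda>i. norm (g i y)) summable_on (I - F)"
      using bnd by (intro Infinite_Sum.abs_summable_on_comparison_test'[OF sumM]) auto
    then have "(\<lambda>i. g i y) summable_on (I - F)"
      by (rule abs_summable_summable)
    then have "(\<Sum>\<^sub>\<infinity>i\<in>(I \<inter> F) \<union> (I-F). g i y) = (\<Sum>\<^sub>\<infinity>i\<in>I \<inter> F. g i y) + (\<Sum>\<^sub>\<infinity>i\<in>I-F. g i y)"
      using r(2) by (intro infsum_Un_disjoint) (auto intro: summable_on_finite)
    moreover have "(I \<inter> F) \<union> (I-F) = I"
      by blast
    ultimately show ?thesis
      using r(2) by simp
  qed
  have "(\<lambda>y. \<Sum>\<^sub>\<infinity>i\<in>I. g i y) holomorphic_on ball x d"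
    by (rule holomorphic_transform[OF holomorphic_on_add[OF hol2 hol1]]) (simp add: eq)
  then show "(\<lambda>x. \<Sum>\<^sub>\<infinity>i\<in>I. g i x) field_differentiable at x within U"
    using d(1) by (meson centre_in_ball field_differentiable_at_within holomorphic_on_imp_differentiable_at open_ball)
qed

text \<open>The arithmetic-geometric mean inequality decouples the indices. With
  \<open>s = \<bar>m\<bar> + \<bar>n\<bar> \<ge> 1\<close>, the product of
  \<open>1 + \<bar>m\<bar>\<close> and \<open>1 + \<bar>n\<bar>\<close> is at most the square of
  \<open>1 + s / 2 \<le> 3 / 2 * s\<close>. Raising this to the power \<open>- 3 / 2\<close>
  dominates the summand by \<open>27 / 8\<close> times a product of two one-variable series with
  exponent \<open>3 / 2 > 1\<close>.\<close>

lemma summable_on_int_pairs_cube: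
  "(\<lambda>(m, n). 1 / (\<bar>real_of_int m\<bar> + \<bar>real_of_int n\<bar>) ^ 3) summable_on (UNIV - {(0, 0)})"
proof -
  define a :: "int \<Rightarrow> real" where "a m = (1 + \<bar>real_of_int m\<bar>) powr (- 3 / 2)" for m
  have "(\<lambda>n. norm (real n powr (- 3 / 2))) = (\<lambda>n. real n powr (- 3 / 2))"
    by auto
  then have s1: "summable (\<lambda>n. norm (real (Suc n) powr (- 3 / 2)))"
    using summable_real_powr_iff[of "-3/2"] by (subst summable_Suc_iff) simp
  have nat: "(\<lambda>n. real (Suc n) powr (- 3 / 2)) summable_on UNIV"
    by (rule norm_summable_imp_summable_on[OF s1])
  have 1: "a summable_on range int"
    using nat by (subst summable_on_reindex) (auto simp: a_def o_def inj_on_def add_ac)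
  have 2: "a summable_on range (\<lambda>n. - int n)"
    using nat by (subst summable_on_reindex) (auto simp: a_def o_def inj_on_def add_ac)
  have "range int \<union> range (\<lambda>n. - int n) = UNIV"
  proof safe
    fix m :: int assume "m \<notin> range (\<lambda>n. - int n)"
    then have "m \<noteq> - int (nat (- m))"
      by blast
    then have "m = int (nat m)"
      by linarith
    then show "m \<in> range int"
      by blast
  qed auto
  then have sa: "a summable_on UNIV"
    using summable_on_union[OF 1 2] by simp
  have "(\<lambda>(m, n). a m * a n) summable_on (UNIV \<times> UNIV)"
  proof (rule summable_on_SigmaI)
    show "((\<lambda>n. case (m, n) of (m, n) \<Rightarrow> a m * a n) has_sum a m * infsum a UNIV) UNIV" for m
      using has_sum_cmult_right[OF has_sum_infsum[OF sa]] by simp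
    show "(\<lambda>m. a m * infsum a UNIV) summable_on UNIV"
      using sa by (rule summable_on_cmult_left)
  qed (auto simp: a_def)
  then have "(\<lambda>p. 27 / 8 * (case p of (m, n) \<Rightarrow> a m * a n)) summable_on (UNIV - {(0, 0)})"
    by (intro summable_on_cmult_right) (auto intro: summable_on_subset_banach)
  then show ?thesis
  proof (rule summable_on_comparison_test)
    fix p :: "int \<times> int" assume p: "p \<in> UNIV - {(0, 0)}"
    obtain m n where mn: "p = (m, n)"
      by (cases p)
    define s where "s = \<bar>real_of_int m\<bar> + \<bar>real_of_int n\<bar>"
    have s: "s \<ge> 1"
    proof -
      have "\<bar>m\<bar> + \<bar>n\<bar> \<ge> 1"
        using p mn by auto
      then have "real_of_int (\<bar>m\<bar> + \<bar>n\<bar>) \<ge> 1"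
        by linarith
      then show ?thesis
        by (simp add: s_def)
    qed
    have amgm: "(1 + x) * (1 + y) \<le> (3 / 2 * (x + y))\<^sup>2" if "x \<ge> 0" "y \<ge> 0" "x + y \<ge> 1" for x y :: real
    proof -
      have "(1 + x) * (1 + y) \<le> (1 + (x + y) / 2)\<^sup>2"
        using zero_le_power2[of "x - y"] by (simp add: power2_eq_square field_simps)
      also have "\<dots> \<le> (3 / 2 * (x + y))\<^sup>2"
        using that by (intro power_mono) (auto simp: field_simps)
      finally show ?thesis .
    qed
    have "a m * a n = ((1 + \<bar>real_of_int m\<bar>) * (1 + \<bar>real_of_int n\<bar>)) powr (- 3 / 2)"
      by (simp add: a_def powr_mult)
    also have "\<dots> \<ge> ((3 / 2 * s)\<^sup>2) powr (- 3 / 2)"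
      using s amgm[of "\<bar>real_of_int m\<bar>" "\<bar>real_of_int n\<bar>"]
      by (intro powr_mono2') (auto simp: s_def add_pos_nonneg)
    also have "((3 / 2 * s)\<^sup>2) powr (- 3 / 2) = (3 / 2 * s) powr (- 3)"
      using s powr_powr[of "3 / 2 * s" 2 "- 3 / 2"] by (simp add: powr_numeral)
    also have "(3 / 2 * s) powr (- 3) = 8 / 27 * (1 / s ^ 3)"
      using s by (simp add: powr_minus powr_numeral power_mult_distrib field_simps)
    finally show "(case p of (m, n) \<Rightarrow> 1 / (\<bar>real_of_int m\<bar> + \<bar>real_of_int n\<bar>) ^ 3)
        \<le> 27 / 8 * (case p of (m, n) \<Rightarrow> a m * a n)"
      by (simp add: mn s_def)
  qed auto
qed

text \<open>The imaginary part of the combination is \<open>y * Im \<tau>\<close>, which controls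
  \<open>y\<close>; the triangle inequality then controls \<open>x\<close>. The constant depends on
  \<tau> only through \<open>\<delta>\<close> and \<open>R\<close>, which gives the uniformity
  needed for holomorphy in \<tau>.\<close>

lemma norm_real_combination_lower_bound:
  fixes \<tau> :: complex
  assumes "Im \<tau> \<ge> \<delta>" "\<delta> > 0" "norm \<tau> \<le> R"
  shows "\<bar>x\<bar> + \<bar>y\<bar> \<le> (1 + (1 + R) / \<delta>) * norm (of_real x + of_real y * \<tau>)"
proof -
  define w where "w = of_real x + of_real y * \<tau>"
  have "\<bar>y\<bar> * \<delta> \<le> \<bar>y\<bar> * Im \<tau>"
    using assms by (intro mult_left_mono) auto
  also have "\<dots> = \<bar>Im w\<bar>"
    using assms by (simp add: w_def abs_mult)
  also have "\<dots> \<le> norm w"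
    by (rule abs_Im_le_cmod)
  finally have y: "\<bar>y\<bar> \<le> norm w / \<delta>"
    using assms by (simp add: field_simps)
  have "\<bar>x\<bar> = norm (w - of_real y * \<tau>)"
    by (simp add: w_def)
  also have "\<dots> \<le> norm w + \<bar>y\<bar> * norm \<tau>"
    by (metis norm_mult norm_of_real norm_triangle_ineq4)
  also have "\<dots> \<le> norm w + norm w / \<delta> * R"
    using y assms by (intro add_left_mono mult_mono) (auto intro: order_trans[OF norm_ge_zero])
  finally show ?thesis
    using y unfolding w_def by (simp add: field_simps add_divide_distrib)
qed

section \<open>Additive structure of a lattice\<close>

lemma zero_in_lattice_gen [simp]: "0 \<in> lattice_gen a b"
  unfolding lattice_gen_def by (rule CollectI, rule exI[of _ 0], rule exI[of _ 0]) simp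

lemma lattice_gen_of_int [intro]: "of_int m * a + of_int n * b \<in> lattice_gen a b"
  unfolding lattice_gen_def by blast

lemma lattice_gen_basis [simp]: "a \<in> lattice_gen a b" "b \<in> lattice_gen a b"
  using lattice_gen_of_int[of 1 a 0 b] lattice_gen_of_int[of 0 a 1 b] by auto

lemma lattice_genE:
  assumes "\<omega> \<in> lattice_gen a b"
  obtains m n where "\<omega> = of_int m * a + of_int n * b"
  using assms unfolding lattice_gen_def by blast

lemma lattice_gen_add: "\<omega> \<in> lattice_gen a b \<Longrightarrow> \<omega>' \<in> lattice_gen a b \<Longrightarrow> \<omega> + \<omega>' \<in> lattice_gen a b"
proof (elim lattice_genE)
  fix m n m' n' assume "\<omega> = of_int m * a + of_int n * b" "\<omega>' = of_int m' * a + of_int n' * b"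
  then have "\<omega> + \<omega>' = of_int (m + m') * a + of_int (n + n') * b"
    by (simp add: algebra_simps)
  then show ?thesis
    using lattice_gen_of_int by metis
qed

lemma lattice_gen_uminus: "\<omega> \<in> lattice_gen a b \<Longrightarrow> - \<omega> \<in> lattice_gen a b"
proof (elim lattice_genE)
  fix m n assume "\<omega> = of_int m * a + of_int n * b"
  then have "- \<omega> = of_int (- m) * a + of_int (- n) * b"
    by simp
  then show ?thesis
    using lattice_gen_of_int by metis
qed

lemma lattice_gen_diff: "\<omega> \<in> lattice_gen a b \<Longrightarrow> \<omega>' \<in> lattice_gen a b \<Longrightarrow> \<omega> - \<omega>' \<in> lattice_gen a b"
  using lattice_gen_add[OF _ lattice_gen_uminus] by fastforce

lemma lattice_gen_uminus_iff [simp]: "- \<omega> \<in> lattice_gen a b \<longleftrightarrow> \<omega> \<in> lattice_gen a b"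
  using lattice_gen_uminus by fastforce

lemma lattice_gen_add_iff:
  assumes "\<omega> \<in> lattice_gen a b"
  shows "z + \<omega> \<in> lattice_gen a b \<longleftrightarrow> z \<in> lattice_gen a b"
  using assms lattice_gen_add lattice_gen_diff by fastforce

section \<open>The Weierstrass zeta function\<close>

definition zeta_term :: "complex \<Rightarrow> complex \<Rightarrow> complex" where
  "zeta_term z \<omega> = 1 / (z - \<omega>) + 1 / \<omega> + z / \<omega>\<^sup>2"

text \<open>The correction terms cancel the expansion of \<open>1 / (z - \<omega>)\<close> through
  second order in \<open>1 / \<omega>\<close>, leaving cubic decay, just enough for convergence over
  a lattice of rank two.\<close>

lemma zeta_term_eq:
  assumes "\<omega> \<noteq> 0" "z \<noteq> \<omega>"
  shows "zeta_term z \<omega> = z\<^sup>2 / (\<omega>\<^sup>2 * (z - \<omega>))"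
  using assms by (simp add: zeta_term_def divide_simps) (simp add: power2_eq_square algebra_simps)

lemma half_not_Ints: "(1 / 2 :: real) \<notin> \<int>"
proof
  assume "(1 / 2 :: real) \<in> \<int>"
  then obtain m :: int where "(1 / 2 :: real) = of_int m"
    by (auto elim: Ints_cases)
  then have "real_of_int (2 * m) = real_of_int 1"
    by simp
  then have "2 * m = 1"
    by (simp only: of_int_eq_iff)
  then show False
    by presburger
qed

text \<open>The basis is general, not normalised to 1 and \<tau>: \<Phi> and \<Psi> refer to all
  oriented bases, homogeneity involves scaled lattices, and the proof of
  \<open>legendre_nonzero\<close> passes to a finer lattice with basis \<open>\<omega>1 / 2\<close>,
  \<open>\<omega>2\<close>.\<close>

locale complex_lattice =
  fixes \<omega>1 \<omega>2 :: complex
  assumes orient: "Im (\<omega>2 / \<omega>1) > 0"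
begin

abbreviation "L \<equiv> lattice_gen \<omega>1 \<omega>2"

lemma norm_combination_lower_bound:
  obtains c where "c > 0"
    "\<And>x y. c * (\<bar>x\<bar> + \<bar>y\<bar>) \<le> norm (of_real x * \<omega>1 + of_real y * \<omega>2)"
proof -
  define \<tau> where "\<tau> = \<omega>2 / \<omega>1"
  define K where "K = 1 + (1 + norm \<tau>) / Im \<tau>"
  have nz: "\<omega>1 \<noteq> 0"
    using orient by auto
  have "Im \<tau> > 0"
    using orient by (simp add: \<tau>_def)
  then have K: "K > 0"
    by (simp add: K_def add_pos_nonneg)
  show ?thesis
  proof (rule that[of "norm \<omega>1 / K"])
    show "norm \<omega>1 / K > 0"
      using K nz by simp
    fix x y :: real
    have "of_real x * \<omega>1 + of_real y * \<omega>2 = \<omega>1 * (of_real x + of_real y * \<tau>)"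
      using nz by (simp add: \<tau>_def field_simps)
    then have "norm (of_real x * \<omega>1 + of_real y * \<omega>2) = norm (\<omega>1 * (of_real x + of_real y * \<tau>))"
      by simp
    also have "\<dots> = norm \<omega>1 * norm (of_real x + of_real y * \<tau>)"
      by (rule norm_mult)
    finally have 1: "norm (of_real x * \<omega>1 + of_real y * \<omega>2) = \<dots>" .
    have "\<bar>x\<bar> + \<bar>y\<bar> \<le> K * norm (of_real x + of_real y * \<tau>)"
      unfolding K_def using \<open>Im \<tau> > 0\<close> by (intro norm_real_combination_lower_bound) auto
    then have "norm \<omega>1 * (\<bar>x\<bar> + \<bar>y\<bar>) \<le> norm \<omega>1 * (K * norm (of_real x + of_real y * \<tau>))"
      by (intro mult_left_mono) auto
    then show "norm \<omega>1 / K * (\<bar>x\<bar> + \<bar>y\<bar>) \<le> norm (of_real x * \<omega>1 + of_real y * \<omega>2)"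
      using K unfolding 1 by (simp add: field_simps)
  qed
qed

lemma real_combination_eq_0_iff:
  "of_real x * \<omega>1 + of_real y * \<omega>2 = 0 \<longleftrightarrow> x = 0 \<and> y = 0"
proof -
  obtain c where c: "c > 0" "\<And>x y. c * (\<bar>x\<bar> + \<bar>y\<bar>) \<le> norm (of_real x * \<omega>1 + of_real y * \<omega>2)"
    using norm_combination_lower_bound by blast
  show ?thesis
  proof
    assume "of_real x * \<omega>1 + of_real y * \<omega>2 = 0"
    then have "c * (\<bar>x\<bar> + \<bar>y\<bar>) \<le> 0"
      using c(2)[of x y] by simp
    then show "x = 0 \<and> y = 0"
      using c(1) by (simp add: mult_le_0_iff) linarith
  qed auto
qed

lemma real_combination_eq_iff:
  "of_real x * \<omega>1 + of_real y * \<omega>2 = of_real x' * \<omega>1 + of_real y' * \<omega>2 \<longleftrightarrow> x = x' \<and> y = y'"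
  using real_combination_eq_0_iff[of "x - x'" "y - y'"] by (simp add: algebra_simps)

lemma \<omega>_nonzero [simp]: "\<omega>1 \<noteq> 0" "\<omega>2 \<noteq> 0"
  using real_combination_eq_0_iff[of 1 0] real_combination_eq_0_iff[of 0 1] by auto

lemma real_combination_in_lattice:
  assumes "of_real x * \<omega>1 + of_real y * \<omega>2 \<in> L"
  shows "x \<in> \<int> \<and> y \<in> \<int>"
proof -
  obtain m n where "of_real x * \<omega>1 + of_real y * \<omega>2 = of_int m * \<omega>1 + of_int n * \<omega>2"
    using assms by (elim lattice_genE)
  then have "x = of_int m \<and> y = of_int n"
    using real_combination_eq_iff[of x y "of_int m" "of_int n"] by simp
  then show ?thesis
    by auto
qed

lemma half_period_notin [simp]: "\<omega>1 / 2 \<notin> L" "\<omega>2 / 2 \<notin> L"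
  using real_combination_in_lattice[of "1/2" 0] real_combination_in_lattice[of 0 "1/2"] half_not_Ints
  by (auto simp: field_simps)

lemma bij_betw_lattice:
  "bij_betw (\<lambda>(m, n). of_int m * \<omega>1 + of_int n * \<omega>2) (UNIV - {(0, 0)}) (L - {0})"
proof -
  have eq0: "of_int m * \<omega>1 + of_int n * \<omega>2 = 0 \<longleftrightarrow> m = 0 \<and> n = 0" for m n
    using real_combination_eq_0_iff[of "of_int m" "of_int n"] by simp
  have eq: "of_int m * \<omega>1 + of_int n * \<omega>2 = of_int m' * \<omega>1 + of_int n' * \<omega>2 \<longleftrightarrow> m = m' \<and> n = n'"
    for m n m' n'
    using real_combination_eq_iff[of "of_int m" "of_int n" "of_int m'" "of_int n'"] by simp
  show ?thesis
  proof (rule bij_betw_imageI)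
    show "inj_on (\<lambda>(m, n). of_int m * \<omega>1 + of_int n * \<omega>2) (UNIV - {(0, 0)})"
      using eq by (auto intro!: inj_onI)
    show "(\<lambda>(m, n). of_int m * \<omega>1 + of_int n * \<omega>2) ` (UNIV - {(0, 0)}) = L - {0}"
      using eq0 by (auto simp: image_iff lattice_gen_of_int elim!: lattice_genE)
  qed
qed

lemma summable_on_inverse_cube: "(\<lambda>\<omega>. 1 / norm \<omega> ^ 3) summable_on (L - {0})"
proof -
  obtain c where c: "c > 0" "\<And>x y. c * (\<bar>x\<bar> + \<bar>y\<bar>) \<le> norm (of_real x * \<omega>1 + of_real y * \<omega>2)"
    using norm_combination_lower_bound by blast
  have "(\<lambda>p. 1 / c ^ 3 * (case p of (m, n) \<Rightarrow> 1 / (\<bar>real_of_int m\<bar> + \<bar>real_of_int n\<bar>) ^ 3))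
          summable_on (UNIV - {(0, 0)})"
    by (intro summable_on_cmult_right summable_on_int_pairs_cube)
  then have "(\<lambda>p. 1 / norm (case p of (m, n) \<Rightarrow> of_int m * \<omega>1 + of_int n * \<omega>2) ^ 3)
               summable_on (UNIV - {(0, 0)})"
  proof (rule summable_on_comparison_test)
    fix p :: "int \<times> int" assume p: "p \<in> UNIV - {(0, 0)}"
    obtain m n where mn: "p = (m, n)"
      by (cases p)
    define s where "s = \<bar>real_of_int m\<bar> + \<bar>real_of_int n\<bar>"
    have s: "s > 0"
      using p mn by (auto simp: s_def)
    have "c * s \<le> norm (of_int m * \<omega>1 + of_int n * \<omega>2)"
      using c(2)[of m n] by (simp add: s_def)
    then have "(c * s) ^ 3 \<le> norm (of_int m * \<omega>1 + of_int n * \<omega>2) ^ 3"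
      using c(1) s by (intro power_mono) auto
    then have "1 / norm (of_int m * \<omega>1 + of_int n * \<omega>2) ^ 3 \<le> 1 / (c * s) ^ 3"
      using zero_less_power[OF mult_pos_pos[OF c(1) s], of 3] by (intro divide_left_mono mult_pos_pos) linarith+
    then show "1 / norm (case p of (m, n) \<Rightarrow> of_int m * \<omega>1 + of_int n * \<omega>2) ^ 3
        \<le> 1 / c ^ 3 * (case p of (m, n) \<Rightarrow> 1 / (\<bar>real_of_int m\<bar> + \<bar>real_of_int n\<bar>) ^ 3)"
      by (simp add: mn s_def power_mult_distrib)
  qed auto
  then show ?thesis
    by (subst summable_on_reindex_bij_betw[OF bij_betw_lattice, symmetric])
qed

lemma finite_lattice_bounded: "finite {\<omega> \<in> L. norm \<omega> \<le> R}"
proof -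
  obtain c where c: "c > 0" "\<And>x y. c * (\<bar>x\<bar> + \<bar>y\<bar>) \<le> norm (of_real x * \<omega>1 + of_real y * \<omega>2)"
    using norm_combination_lower_bound by blast
  define N where "N = \<lceil>R / c\<rceil>"
  have "{\<omega> \<in> L. norm \<omega> \<le> R} \<subseteq> (\<lambda>(m, n). of_int m * \<omega>1 + of_int n * \<omega>2) ` ({-N..N} \<times> {-N..N})"
  proof safe
    fix \<omega> assume "\<omega> \<in> L" and R: "norm \<omega> \<le> R"
    then obtain m n where mn: "\<omega> = of_int m * \<omega>1 + of_int n * \<omega>2"
      by (elim lattice_genE)
    have "c * (\<bar>real_of_int m\<bar> + \<bar>real_of_int n\<bar>) \<le> R"
      using c(2)[of m n] R mn by simp
    then have "\<bar>real_of_int m\<bar> + \<bar>real_of_int n\<bar> \<le> R / c"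
      using c(1) by (simp add: field_simps)
    then have "\<bar>real_of_int m\<bar> \<le> of_int N" "\<bar>real_of_int n\<bar> \<le> of_int N"
      unfolding N_def using le_of_int_ceiling[of "R / c"] by linarith+
    then have "m \<in> {-N..N}" "n \<in> {-N..N}"
      by (simp_all add: abs_le_iff flip: of_int_minus)
    then show "\<omega> \<in> (\<lambda>(m, n). of_int m * \<omega>1 + of_int n * \<omega>2) ` ({-N..N} \<times> {-N..N})"
      using mn by auto
  qed
  then show ?thesis
    by (rule finite_subset) auto
qed

lemma not_islimpt_lattice: "\<not> z islimpt L"
proof
  assume "z islimpt L"
  then have "infinite (L \<inter> ball z 1)"
    by (simp add: islimpt_eq_infinite_ball)
  moreover have "L \<inter> ball z 1 \<subseteq> {\<omega> \<in> L. norm \<omega> \<le> norm z + 1}"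
  proof safe
    fix \<omega> assume "\<omega> \<in> ball z 1"
    then show "norm \<omega> \<le> norm z + 1"
      using norm_triangle_ineq[of z "\<omega> - z"] by (simp add: dist_norm norm_minus_commute)
  qed
  ultimately show False
    using finite_lattice_bounded finite_subset by blast
qed

lemma closed_subset_lattice: "X \<subseteq> L \<Longrightarrow> closed X"
  using not_islimpt_lattice by (meson closed_limpt islimpt_subset)

lemma connected_Compl_lattice: "connected (- L)"
proof -
  have "L sparse_in UNIV"
    using not_islimpt_lattice by (auto simp: sparse_in_def)
  then have "connected (UNIV - L)"
    by (intro sparse_imp_connected) auto
  then show ?thesis
    by (simp add: Compl_eq_Diff_UNIV)
qed

lemma eventually_notin_lattice: "\<forall>\<^sub>F z in at x. z \<notin> L"
  using not_islimpt_lattice islimpt_iff_eventually by blast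

lemma norm_zeta_term_le:
  assumes "\<omega> \<noteq> 0" "norm \<omega> \<ge> 2 * norm z"
  shows "norm (zeta_term z \<omega>) \<le> 2 * (norm z)\<^sup>2 * (1 / norm \<omega> ^ 3)"
proof -
  have z: "norm (z - \<omega>) \<ge> norm \<omega> / 2"
    using norm_triangle_ineq2[of \<omega> z] assms by (simp add: norm_minus_commute)
  then have "z \<noteq> \<omega>"
    using assms by auto
  then have "norm (zeta_term z \<omega>) = (norm z)\<^sup>2 / ((norm \<omega>)\<^sup>2 * norm (z - \<omega>))"
    using assms by (simp add: zeta_term_eq norm_divide norm_mult norm_power)
  also have "\<dots> \<le> (norm z)\<^sup>2 / ((norm \<omega>)\<^sup>2 * (norm \<omega> / 2))"
    using z assms by (intro divide_left_mono mult_left_mono mult_pos_pos) (auto intro: less_le_trans[of _ "norm \<omega> / 2"])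
  also have "\<dots> = 2 * (norm z)\<^sup>2 * (1 / norm \<omega> ^ 3)"
    by (simp add: power2_eq_square power3_eq_cube)
  finally show ?thesis .
qed

lemma summable_on_zeta_term: "zeta_term z summable_on L"
proof -
  define F where "F = insert 0 {\<omega> \<in> L. norm \<omega> \<le> 2 * norm z}"
  have F: "finite F" "F \<subseteq> L"
    using finite_lattice_bounded by (auto simp: F_def)
  have "(\<lambda>\<omega>. 2 * (norm z)\<^sup>2 * (1 / norm \<omega> ^ 3)) summable_on (L - F)"
    by (intro summable_on_cmult_right summable_on_subset_banach[OF summable_on_inverse_cube]) (auto simp: F_def)
  then have "(\<lambda>\<omega>. norm (zeta_term z \<omega>)) summable_on (L - F)"
    by (rule Infinite_Sum.abs_summable_on_comparison_test') (use norm_zeta_term_le in \<open>auto simp: F_def\<close>)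
  then have "zeta_term z summable_on (L - F)"
    by (rule abs_summable_summable)
  then have "zeta_term z summable_on ((L - F) \<union> F)"
    using F(1) by (intro summable_on_union) auto
  then show ?thesis
    using F(2) by (simp add: Un_absorb2)
qed

text \<open>Zeta without its principal part at 0. Being holomorphic there, it shows that the pole of
  zeta at 0 is simple with residue 1.\<close>

definition zeta_regular_part :: "complex \<Rightarrow> complex" where
  "zeta_regular_part z = (\<Sum>\<^sub>\<infinity>\<omega>\<in>L - {0}. zeta_term z \<omega>)"

lemma weierstrass_zeta_eq: "weierstrass_zeta L z = 1 / z + zeta_regular_part z"
  by (simp add: weierstrass_zeta_def zeta_regular_part_def zeta_term_def)

lemma holomorphic_zeta_regular_part: "zeta_regular_part holomorphic_on - (L - {0})"
  unfolding zeta_regular_part_def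
proof (rule holomorphic_on_infsum)
  show "open (- (L - {0}))"
    by (intro open_Compl closed_subset_lattice) auto
  show "(\<lambda>z. zeta_term z \<omega>) holomorphic_on - (L - {0})" if "\<omega> \<in> L - {0}" for \<omega>
    unfolding zeta_term_def using that by (intro holomorphic_intros) auto
  fix z assume "z \<in> - (L - {0})"
  \<comment> \<open>Points of the unit ball around \<open>z\<close> have norm at most
    \<open>norm z + 1\<close>, so outside \<open>F\<close> the hypothesis of
    \<open>norm_zeta_term_le\<close> holds for all of them at once.\<close>
  define F where "F = {\<omega> \<in> L. norm \<omega> \<le> 2 * (norm z + 1)}"
  define M where "M \<omega> = 2 * (norm z + 1)\<^sup>2 * (1 / norm \<omega> ^ 3)" for \<omega> :: complex
  have "norm (zeta_term y \<omega>) \<le> M \<omega>" if \<omega>: "\<omega> \<in> L - {0} - F" and "y \<in> ball z 1" for \<omega> y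
  proof -
    have y: "norm y \<le> norm z + 1"
      using that(2) norm_triangle_ineq[of z "y - z"] by (simp add: dist_norm norm_minus_commute)
    have "norm (zeta_term y \<omega>) \<le> 2 * (norm y)\<^sup>2 * (1 / norm \<omega> ^ 3)"
      using \<omega> y by (intro norm_zeta_term_le) (auto simp: F_def)
    also have "\<dots> \<le> M \<omega>"
      unfolding M_def using y by (intro mult_right_mono mult_left_mono power_mono) auto
    finally show ?thesis .
  qed
  moreover have "M summable_on (L - {0})"
    unfolding M_def by (intro summable_on_cmult_right summable_on_inverse_cube)
  moreover have "finite F"
    unfolding F_def by (rule finite_lattice_bounded)
  ultimately show "\<exists>M F r. r > 0 \<and> finite F \<and> M summable_on (L - {0}) \<and>
      (\<forall>\<omega>\<in>L - {0} - F. \<forall>y\<in>ball z r. norm (zeta_term y \<omega>) \<le> M \<omega>)"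
    by (intro exI[of _ M] exI[of _ F] exI[of _ 1]) auto
qed

lemma holomorphic_weierstrass_zeta: "weierstrass_zeta L holomorphic_on - L"
proof -
  have "(\<lambda>z. 1 / z + zeta_regular_part z) holomorphic_on - L"
    by (intro holomorphic_intros holomorphic_on_subset[OF holomorphic_zeta_regular_part]) auto
  then show ?thesis
    by (simp add: weierstrass_zeta_eq[abs_def])
qed

text \<open>Division by zero makes the term for \<open>\<omega> = 0\<close> equal to \<open>1 / z\<close>.\<close>

lemma weierstrass_zeta_eq_infsum: "weierstrass_zeta L z = infsum (zeta_term z) L"
proof -
  have "infsum (zeta_term z) ({0} \<union> (L - {0})) = infsum (zeta_term z) {0} + infsum (zeta_term z) (L - {0})"
    by (intro infsum_Un_disjoint summable_on_subset_banach[OF summable_on_zeta_term]) auto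
  moreover have "{0} \<union> (L - {0}) = L"
    by auto
  ultimately show ?thesis
    by (simp add: weierstrass_zeta_def zeta_term_def[abs_def])
qed

lemma weierstrass_zeta_minus: "weierstrass_zeta L (- z) = - weierstrass_zeta L z"
proof -
  have "infsum (zeta_term (- z)) L = infsum (\<lambda>\<omega>. - zeta_term z \<omega>) L"
  proof (rule infsum_reindex_bij_witness[of _ uminus uminus])
    fix \<omega>
    have "1 / (- z - \<omega>) = - (1 / (z - (- \<omega>)))"
      by (simp add: minus_divide_right)
    then show "- zeta_term z (- \<omega>) = zeta_term (- z) \<omega>"
      by (simp add: zeta_term_def)
  qed auto
  then show ?thesis
    by (simp add: weierstrass_zeta_eq_infsum infsum_uminus)
qed

text \<open>Instead of differentiating zeta, subtract the two series term by term after translating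
  the summation index by \<omega>. The identity even holds at lattice points, because division by
  zero assigns consistent values there; this is what makes evaluation at 0 legitimate in
  \<open>weierstrass_eta_add\<close>.\<close>

lemma weierstrass_zeta_quasiperiodic:
  assumes \<omega>: "\<omega> \<in> L"
  shows "\<exists>h. \<forall>z. weierstrass_zeta L (z + \<omega>) = weierstrass_zeta L z + h"
proof -
  let ?\<zeta> = "weierstrass_zeta L"
  define d where "d z \<nu> = zeta_term (z + \<omega>) (\<nu> + \<omega>) - zeta_term z \<nu>" for z \<nu>
  have bij: "bij_betw (\<lambda>\<nu>. \<nu> + \<omega>) L L"
    using \<omega> by (intro bij_betw_byWitness[where f' = "\<lambda>\<nu>. \<nu> - \<omega>"]) (auto intro: lattice_gen_add lattice_gen_diff)
  have s: "(\<lambda>\<nu>. zeta_term (z + \<omega>) (\<nu> + \<omega>)) summable_on L" for z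
    by (subst summable_on_reindex_bij_betw[OF bij]) (rule summable_on_zeta_term)
  have diff: "(\<lambda>\<nu>. f \<nu> - g \<nu>) summable_on L" if "f summable_on L" "g summable_on L" for f g :: "complex \<Rightarrow> complex"
    using summable_on_add[OF that(1) summable_on_uminus[THEN iffD2, OF that(2)]] by simp
  have sd: "d z summable_on L" for z
    unfolding d_def by (intro diff s summable_on_zeta_term)
  have shift: "?\<zeta> (z + \<omega>) - ?\<zeta> z = infsum (d z) L" for z
  proof -
    have "infsum (d z) L = (\<Sum>\<^sub>\<infinity>\<nu>\<in>L. zeta_term (z + \<omega>) (\<nu> + \<omega>) + - zeta_term z \<nu>)"
      by (rule infsum_cong) (simp add: d_def)
    also have "\<dots> = infsum (zeta_term (z + \<omega>)) L - infsum (zeta_term z) L"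
      by (subst infsum_add[OF s summable_on_uminus[THEN iffD2, OF summable_on_zeta_term]])
         (simp add: infsum_uminus infsum_reindex_bij_betw[OF bij])
    finally show ?thesis
      by (simp add: weierstrass_zeta_eq_infsum)
  qed
  define a where "a = infsum (\<lambda>\<nu>. d 1 \<nu> - d 0 \<nu>) L"
  define b where "b = infsum (d 0) L"
  \<comment> \<open>The fractions \<open>1 / (z - \<nu>)\<close> cancel exactly, also when
    \<open>z = \<nu>\<close>; what remains is affine in \<open>z\<close>.\<close>
  have d_linear: "d z \<nu> = d 0 \<nu> + z * (d 1 \<nu> - d 0 \<nu>)" for z \<nu>
  proof -
    have *: "z + \<omega> - (\<nu> + \<omega>) = z - \<nu>" for z
      by simp
    show ?thesis
      unfolding d_def zeta_term_def * by (simp add: add_divide_distrib algebra_simps)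
  qed
  have lin: "?\<zeta> (z + \<omega>) = ?\<zeta> z + b + z * a" for z
  proof -
    have "infsum (d z) L = (\<Sum>\<^sub>\<infinity>\<nu>\<in>L. d 0 \<nu> + z * (d 1 \<nu> - d 0 \<nu>))"
      by (intro infsum_cong d_linear)
    also have "\<dots> = b + z * a"
      unfolding a_def b_def
      by (subst infsum_add[OF sd summable_on_cmult_right[OF diff[OF sd sd]]]) (simp add: infsum_cmult_right')
    finally show ?thesis
      using shift[of z] by (simp add: algebra_simps)
  qed
  text \<open>Since \<open>\<zeta>\<close> is odd, \<open>\<zeta> (z + \<omega>) - \<zeta> z\<close> is invariant under \<open>z \<mapsto> - z - \<omega>\<close>, so its slope \<open>a\<close> is \<open>0\<close>.\<close>
  have "x * a * 2 = \<omega> * a" for x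
  proof -
    have "- ?\<zeta> (x - \<omega>) = - ?\<zeta> x + b - x * a"
      using lin[of "- x"] weierstrass_zeta_minus[of x] weierstrass_zeta_minus[of "x - \<omega>"] by simp
    moreover have "?\<zeta> x = ?\<zeta> (x - \<omega>) + b + (x - \<omega>) * a"
      using lin[of "x - \<omega>"] by simp
    ultimately show ?thesis
      by (simp add: algebra_simps)
  qed
  from this[of 0] this[of 1] have "a = 0"
    by auto
  then show ?thesis
    using lin by auto
qed

end

lemma quasi_period_eqI:
  assumes "is_quasi_period f \<omega> h" "\<not> is_pole f z"
  shows "quasi_period f \<omega> = h"
  unfolding quasi_period_def
proof (rule the_equality)
  fix h' assume "is_quasi_period f \<omega> h'"
  then show "h' = h"
    using assms unfolding is_quasi_period_def by (metis add_left_cancel)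
qed (rule assms)

lemma periodic_lattice_gen:
  fixes F :: "complex \<Rightarrow> 'a"
  assumes "\<And>z. F (z + a) = F z" "\<And>z. F (z + b) = F z" "\<omega> \<in> lattice_gen a b"
  shows "F (z + \<omega>) = F z"
proof -
  have mult: "F (z + of_int m * p) = F z" if p: "\<And>z. F (z + p) = F z" for m p z
  proof (induction m arbitrary: z rule: int_induct[where k = 0])
    case (step1 m)
    then show ?case
      using p[of "z + of_int m * p"] by (simp add: algebra_simps)
  next
    case (step2 m)
    then show ?case
      using p[of "z + of_int (m - 1) * p"] by (simp add: algebra_simps)
  qed auto
  obtain m n where "\<omega> = of_int m * a + of_int n * b"
    using assms(3) by (elim lattice_genE)
  then show ?thesis
    using mult[OF assms(1), of z m] mult[OF assms(2), of "z + of_int m * a" n] by (simp add: add_ac)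
qed

section \<open>Poles and quasi-periods of zeta, and the Legendre determinant\<close>

context complex_lattice
begin

lemma real_combination_surj: "\<exists>x y. z = of_real x * \<omega>1 + of_real y * \<omega>2"
proof -
  define \<tau> where "\<tau> = \<omega>2 / \<omega>1"
  define y where "y = Im (z / \<omega>1) / Im \<tau>"
  define x where "x = Re (z / \<omega>1) - y * Re \<tau>"
  have "Im \<tau> \<noteq> 0"
    using orient by (simp add: \<tau>_def)
  then have "z / \<omega>1 = of_real x + of_real y * \<tau>"
    by (simp add: complex_eq_iff x_def y_def)
  then have "z = of_real x * \<omega>1 + of_real y * \<omega>2"
    by (simp add: \<tau>_def field_simps)
  then show ?thesis
    by blast
qed

text \<open>Every value is attained on the closed fundamental parallelogram.\<close>

lemma bounded_range_periodic:
  assumes "continuous_on UNIV F" "\<And>z \<omega>. \<omega> \<in> L \<Longrightarrow> F (z + \<omega>) = F z"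
  shows "bounded (range F :: complex set)"
proof -
  define P where "P = (\<lambda>(x, y). of_real x * \<omega>1 + of_real y * \<omega>2) ` ({0..1::real} \<times> {0..1::real})"
  have "compact P"
    unfolding P_def case_prod_unfold
    by (intro compact_continuous_image compact_Times continuous_intros) auto
  then have "bounded (F ` P)"
    using assms(1) by (intro compact_imp_bounded compact_continuous_image) (auto intro: continuous_on_subset)
  moreover have "range F \<subseteq> F ` P"
  proof safe
    fix z
    obtain x y where z: "z = of_real x * \<omega>1 + of_real y * \<omega>2"
      using real_combination_surj by blast
    define w where "w = of_real (frac x) * \<omega>1 + of_real (frac y) * \<omega>2"
    have "w \<in> P"
      unfolding P_def w_def by (rule image_eqI[of _ _ "(frac x, frac y)"]) (auto simp: less_imp_le[OF frac_lt_1])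
    moreover have "z = w + (of_int \<lfloor>x\<rfloor> * \<omega>1 + of_int \<lfloor>y\<rfloor> * \<omega>2)"
      by (simp add: z w_def frac_def algebra_simps)
    then have "F z = F w"
      using assms(2) lattice_gen_of_int by metis
    ultimately show "F z \<in> F ` P"
      by blast
  qed
  ultimately show ?thesis
    by (rule bounded_subset)
qed

lemma is_pole_weierstrass_zeta_0: "is_pole (weierstrass_zeta L) 0"
proof -
  have "open (- (L - {0}))"
    by (intro open_Compl closed_subset_lattice) auto
  moreover have "(\<lambda>z. 1 + z * zeta_regular_part z) holomorphic_on - (L - {0})"
    by (intro holomorphic_intros holomorphic_zeta_regular_part)
  ultimately have "is_pole (\<lambda>z. (1 + z * zeta_regular_part z) / z ^ 1) 0"
    by (intro is_pole_basic') auto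
  moreover have "\<forall>\<^sub>F z in at 0. (1 + z * zeta_regular_part z) / z ^ 1 = weierstrass_zeta L z"
    unfolding eventually_at_filter by (auto simp: weierstrass_zeta_eq field_simps)
  ultimately show ?thesis
    by (rule is_pole_transform) simp
qed

lemma not_is_pole_weierstrass_zeta:
  assumes "z \<notin> L"
  shows "\<not> is_pole (weierstrass_zeta L) z"
  using assms by (intro not_is_pole_holomorphic[OF _ _ holomorphic_weierstrass_zeta])
    (auto intro!: open_Compl closed_subset_lattice)

lemma weierstrass_zeta_add_period:
  assumes "\<omega> \<in> L"
  shows "weierstrass_zeta L (z + \<omega>) = weierstrass_zeta L z + weierstrass_eta L \<omega>"
proof -
  obtain h where h: "\<And>z. weierstrass_zeta L (z + \<omega>) = weierstrass_zeta L z + h"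
    using weierstrass_zeta_quasiperiodic[OF assms] by blast
  then have "is_quasi_period (weierstrass_zeta L) \<omega> h"
    by (simp add: is_quasi_period_def)
  then have "weierstrass_eta L \<omega> = h"
    unfolding weierstrass_eta_def
    by (rule quasi_period_eqI[of _ _ _ "\<omega>1 / 2"]) (simp add: not_is_pole_weierstrass_zeta)
  then show ?thesis
    by (simp add: h)
qed

lemma is_pole_weierstrass_zeta_iff: "is_pole (weierstrass_zeta L) z \<longleftrightarrow> z \<in> L"
proof
  assume "z \<in> L"
  have "(\<lambda>x. weierstrass_zeta L (z + x)) = (\<lambda>x. weierstrass_zeta L x + weierstrass_eta L z)"
    using weierstrass_zeta_add_period[OF \<open>z \<in> L\<close>] by (simp add: add.commute)
  then show "is_pole (weierstrass_zeta L) z"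
    using is_pole_weierstrass_zeta_0 is_pole_shift_0 is_pole_plus_const_iff by metis
qed (use not_is_pole_weierstrass_zeta in blast)

lemma weierstrass_eta_add:
  assumes "\<omega> \<in> L" "\<omega>' \<in> L"
  shows "weierstrass_eta L (\<omega> + \<omega>') = weierstrass_eta L \<omega> + weierstrass_eta L \<omega>'"
  using weierstrass_zeta_add_period[OF lattice_gen_add[OF assms], of 0]
    weierstrass_zeta_add_period[OF assms(1), of 0] weierstrass_zeta_add_period[OF assms(2), of "0 + \<omega>"]
  by (simp add: add_ac)

text \<open>Translation by \<omega> takes \<open>- (\<omega> / 2)\<close> to
  \<open>\<omega> / 2\<close>, and zeta is odd. This replaces a definite description by a series
  whose dependence on the lattice can be studied.\<close>

lemma weierstrass_eta_eq_zeta: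
  assumes "\<omega> \<in> L"
  shows "weierstrass_eta L \<omega> = 2 * weierstrass_zeta L (\<omega> / 2)"
  using weierstrass_zeta_add_period[OF assms, of "- (\<omega> / 2)"] weierstrass_zeta_minus[of "\<omega> / 2"] by simp

text \<open>
  The left-hand side equals \<open>2 \<pi> \<i>\<close> by Legendre's relation, but only its non-vanishing matters.
  If it vanished, then \<open>f z = \<zeta> z + c z\<close> would be elliptic for some \<open>c\<close>. As \<open>f\<close> is odd, it
  vanishes at half-periods, so the zero of one factor of \<open>f z * f (z + \<omega>1 / 2)\<close> cancels the
  simple pole of the other. The product is thus constant, and it is \<open>0\<close> at \<open>\<omega>2 / 2\<close>.
\<close>

lemma legendre_nonzero: "\<omega>2 * weierstrass_eta L \<omega>1 - \<omega>1 * weierstrass_eta L \<omega>2 \<noteq> 0"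
proof
  assume D0: "\<omega>2 * weierstrass_eta L \<omega>1 - \<omega>1 * weierstrass_eta L \<omega>2 = 0"
  \<comment> \<open>This \<open>c\<close> cancels the quasi-period at \<open>\<omega>1\<close>; by
    \<open>D0\<close> it also cancels the one at \<open>\<omega>2\<close>.\<close>
  define c where "c = - weierstrass_eta L \<omega>1 / \<omega>1"
  define f where "f z = weierstrass_zeta L z + c * z" for z
  define u where "u = \<omega>1 / 2"
  \<comment> \<open>Translation by \<open>u\<close> swaps the factors of the product
    \<open>f z * f (z + u)\<close>, up to the period \<open>\<omega>1\<close>. The product is
    therefore periodic for the finer lattice spanned by \<open>u\<close> and
    \<open>\<omega>2\<close>, and one limit at 0 settles all its singularities.\<close>
  have "\<omega>2 / u = \<omega>2 / \<omega>1 + \<omega>2 / \<omega>1"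
    by (simp add: u_def)
  then have "Im (\<omega>2 / u) > 0"
    using orient by (simp only: plus_complex.sel add_pos_pos)
  then interpret M: complex_lattice u \<omega>2
    by unfold_locales
  have c: "c * \<omega>1 = - weierstrass_eta L \<omega>1" "c * \<omega>2 = - weierstrass_eta L \<omega>2"
    using D0 by (auto simp: c_def field_simps)
  have per1: "f (z + \<omega>1) = f z" for z
    using c(1) weierstrass_zeta_add_period[of \<omega>1 z] by (simp add: f_def algebra_simps)
  have per2: "f (z + \<omega>2) = f z" for z
    using c(2) weierstrass_zeta_add_period[of \<omega>2 z] by (simp add: f_def algebra_simps)
  have odd: "f (- z) = - f z" for z
    by (simp add: f_def weierstrass_zeta_minus)
  have fu: "f u = 0"
    \<comment> \<open>Since \<open>- u + \<omega>1 = u\<close>, periodicity and oddness give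
      \<open>f u = - f u\<close>.\<close>
    using per1[of "- u"] odd[of u] by (simp add: u_def)
  have fv: "f (\<omega>2 / 2) = 0"
    using per2[of "- (\<omega>2 / 2)"] odd[of "\<omega>2 / 2"] by simp
  have open_L: "open (- L)" "open (- M.L)"
    using closed_subset_lattice[OF order_refl] M.closed_subset_lattice[OF order_refl] by (auto intro: open_Compl)
  have hol_f: "f holomorphic_on - L"
    unfolding f_def by (intro holomorphic_intros holomorphic_weierstrass_zeta)
  have LM: "z \<in> M.L" if z: "z \<in> L" for z
  proof -
    obtain m n where "z = of_int m * \<omega>1 + of_int n * \<omega>2"
      using z by (elim lattice_genE)
    then have "z = of_int (2 * m) * u + of_int n * \<omega>2"
      by (simp add: u_def)
    then show ?thesis
      using lattice_gen_of_int by metis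
  qed
  have LM': "z \<in> M.L" if "z + u \<in> L" for z
    using lattice_gen_diff[OF LM[OF that], of u] by simp
  have hol_shift: "(\<lambda>z. f (z + u)) holomorphic_on - M.L"
  proof -
    have "(f \<circ> (\<lambda>z. z + u)) holomorphic_on - M.L"
      by (rule holomorphic_on_compose_gen[OF _ hol_f]) (use LM' in \<open>auto intro!: holomorphic_intros\<close>)
    then show ?thesis
      by (simp add: o_def)
  qed
  define g where "g z = f z * f (z + u)" for z
  have hol_g: "g holomorphic_on - M.L"
    unfolding g_def using LM by (intro holomorphic_intros hol_shift holomorphic_on_subset[OF hol_f]) auto
  have gu: "g (z + u) = g z" for z
    using per1[of z] by (simp add: g_def u_def add.assoc)
  have g2: "g (z + \<omega>2) = g z" for z
    using per2[of z] per2[of "z + u"] by (simp add: g_def add_ac)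
  have per_g: "g (z + \<omega>) = g z" if "\<omega> \<in> M.L" for z \<omega>
    using periodic_lattice_gen[OF gu g2 that] .
  \<comment> \<open>Near 0 the factors behave like \<open>1 / z\<close> and \<open>l * z\<close>, so
    \<open>l\<close> is the value that removes the singularity of \<open>g\<close>.\<close>
  define l where "l = deriv f u"
  have "u \<notin> L"
    by (simp add: u_def)
  then have "(f has_field_derivative l) (at u)"
    unfolding l_def using hol_f open_L(1) by (intro holomorphic_derivI[of _ "- L"]) auto
  then have lim1: "((\<lambda>z. f (u + z) / z) \<longlongrightarrow> l) (at 0)"
    by (simp add: DERIV_def fu)
  have "zeta_regular_part field_differentiable at 0"
    using closed_subset_lattice[of "L - {0}"]
    by (intro holomorphic_on_imp_differentiable_at[OF holomorphic_zeta_regular_part]) (auto simp del: Compl_Diff_eq)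
  then have "isCont zeta_regular_part 0"
    by (rule field_differentiable_imp_continuous_at)
  then have lim2: "((\<lambda>z. 1 + z * (zeta_regular_part z + c * z)) \<longlongrightarrow> 1 + 0 * (zeta_regular_part 0 + c * 0)) (at 0)"
    by (intro tendsto_intros) (simp add: isCont_def)
  have "((\<lambda>z. (1 + z * (zeta_regular_part z + c * z)) * (f (u + z) / z)) \<longlongrightarrow> l) (at 0)"
    using tendsto_mult[OF lim2 lim1] by simp
  moreover have "\<forall>\<^sub>F z in at 0. (1 + z * (zeta_regular_part z + c * z)) * (f (u + z) / z) = g z"
    unfolding eventually_at_filter
    by (rule always_eventually) (auto simp: g_def f_def[of z for z] weierstrass_zeta_eq field_simps)
  ultimately have lim_g0: "(g \<longlongrightarrow> l) (at 0)"
    using tendsto_cong by fastforce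
  have lim_g: "(g \<longlongrightarrow> l) (at p)" if "p \<in> M.L" for p
  proof -
    have "(\<lambda>h. g (p + h)) = g"
      using per_g[OF that] by (simp add: add.commute)
    then show ?thesis
      using lim_g0 by (simp add: LIM_offset_zero_iff[of p g])
  qed
  define G where "G z = (if z \<in> M.L then l else g z)" for z
  have per_G: "G (z + \<omega>) = G z" if "\<omega> \<in> M.L" for z \<omega>
    using that per_g lattice_gen_add_iff[OF that] by (simp add: G_def)
  have ev: "\<forall>\<^sub>F z in at p. g z = G z" for p
    using M.eventually_notin_lattice by eventually_elim (simp add: G_def)
  have cont: "isCont G z" for z
  proof (cases "z \<in> M.L")
    case True
    then have "G z = l"
      by (simp add: G_def)
    then show ?thesis
      using lim_g[OF True] tendsto_cong[OF ev, of l z] by (simp add: isCont_def)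
  next
    case False
    then have "isCont g z"
      using hol_g open_L(2) by (metis ComplI continuous_on_eq_continuous_at holomorphic_on_imp_continuous_on)
    moreover have "G z = g z"
      using False by (simp add: G_def)
    ultimately show ?thesis
      using tendsto_cong[OF ev, of "g z" z] by (simp add: isCont_def)
  qed
  have "G field_differentiable at z" for z
  proof -
    define U where "U = - (M.L - {z})"
    have U: "open U" "z \<in> U"
      unfolding U_def by (auto intro: open_Compl[OF M.closed_subset_lattice[OF Diff_subset]] simp del: Compl_Diff_eq)
    have hol: "G holomorphic_on U - {z}"
      by (rule holomorphic_transform[OF holomorphic_on_subset[OF hol_g]]) (auto simp: G_def U_def)
    have "continuous_on U G"
      using cont by (intro continuous_at_imp_continuous_on) blast
    then have "G holomorphic_on U"
      using hol U(1) by (rule no_isolated_singularity) simp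
    then show ?thesis
      using U by (rule holomorphic_on_imp_differentiable_at)
  qed
  then have "G holomorphic_on UNIV"
    by (simp add: holomorphic_on_def)
  moreover have "bounded (range G)"
    using cont per_G by (intro M.bounded_range_periodic) (auto intro: continuous_at_imp_continuous_on)
  ultimately have "G constant_on UNIV"
    by (rule Liouville_theorem)
  then have "G z = G (\<omega>2 / 2)" for z
    unfolding constant_on_def by fastforce
  \<comment> \<open>The point \<open>\<omega>2 / 2\<close> is still outside the finer lattice, so
    \<open>G\<close> equals \<open>g\<close> there, and the first factor of \<open>g\<close>
    vanishes.\<close>
  also have "G (\<omega>2 / 2) = 0"
    by (simp add: G_def g_def fv)
  finally have g0: "g z = 0" if "z \<notin> M.L" for z
    using that unfolding G_def by metis
  \<comment> \<open>The product is now zero, but \<open>f\<close> is nonzero near its pole 0. Hence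
    \<open>f\<close> vanishes near \<open>u\<close>, by the identity theorem on all of
    \<open>- L\<close>, and so near 0 as well: a contradiction.\<close>
  have "is_pole f 0"
  proof -
    have "((\<lambda>z. c * z) \<longlongrightarrow> c * 0) (at 0)"
      by (intro tendsto_intros)
    then have "LIM z at 0. c * z + weierstrass_zeta L z :> at_infinity"
      using is_pole_weierstrass_zeta_0 unfolding is_pole_def by (rule tendsto_add_filterlim_at_infinity)
    then show ?thesis
      unfolding is_pole_def f_def by (simp add: add.commute)
  qed
  then have nz: "\<forall>\<^sub>F z in at 0. f z \<noteq> 0"
    unfolding is_pole_def by (rule filterlim_at_infinity_imp_eventually_ne)
  then have "\<forall>\<^sub>F z in at 0. f (z + u) = 0"
    using M.eventually_notin_lattice by eventually_elim (use g0 in \<open>auto simp: g_def\<close>)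
  then have "\<forall>\<^sub>F z in at u. f z = 0"
    by (subst at_to_0) (simp add: eventually_filtermap)
  then have "\<forall>\<^sub>F z in at u. z \<in> {z. z \<notin> L \<and> f z = 0}"
    using eventually_notin_lattice by eventually_elim auto
  then have lp: "u islimpt {z. z \<notin> L \<and> f z = 0}"
    unfolding islimpt_conv_frequently_at by (intro eventually_frequently) auto
  have f0: "f z = 0" if "z \<notin> L" for z
    by (rule analytic_continuation[OF hol_f open_L(1) connected_Compl_lattice _ _ lp])
       (use that \<open>u \<notin> L\<close> in auto)
  have "\<forall>\<^sub>F z in at 0. f z = 0"
    using eventually_notin_lattice by eventually_elim (rule f0)
  with nz have "\<forall>\<^sub>F z in at (0 :: complex). False"
    by eventually_elim auto
  then show False
    by simp
qed

end

section \<open>Dependence on the lattice\<close>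

text \<open>Gives the linear growth of the distance from a half-period to the lattice points. The
  bound covers every \<open>m\<close>, so the majorant in \<tau> needs no excluded finite
  set.\<close>

lemma half_Ints_diff_ge:
  assumes "a \<in> {0, 1 / 2 :: real}"
  shows "\<bar>real_of_int m\<bar> / 2 \<le> \<bar>a - real_of_int m\<bar>"
proof (cases "m = 0")
  case False
  then have "real_of_int m \<ge> 1 \<or> real_of_int m \<le> - 1"
    by linarith
  then show ?thesis
    using assms by auto
qed (use assms in auto)

lemma complex_lattice_1: "Im \<tau> > 0 \<Longrightarrow> complex_lattice 1 \<tau>"
  by unfold_locales simp

lemma open_upper_half_plane [simp, intro]: "open upper_half_plane"
  unfolding upper_half_plane_def by (rule open_halfspace_Im_gt)

text \<open>Both the lattice and the evaluation point move with \<tau>. Indexing by pairs of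
  integers fixes the summation set, and a half-period never meets the lattice, so each term is
  holomorphic on the whole half-plane. The parameters \<open>a\<close> and \<open>b\<close> cover
  \<open>1 / 2\<close> and \<open>\<tau> / 2\<close> together.\<close>

lemma weierstrass_zeta_half_period_holomorphic:
  fixes a b :: real
  assumes a: "a \<in> {0, 1 / 2}" and b: "b \<in> {0, 1 / 2}" and ab: "a \<noteq> 0 \<or> b \<noteq> 0"
  shows "(\<lambda>\<tau>. weierstrass_zeta (lattice_of \<tau>) (of_real a + of_real b * \<tau>)) holomorphic_on upper_half_plane"
proof -
  define I :: "(int \<times> int) set" where "I = UNIV - {(0, 0)}"
  define w where "w p \<tau> = (case p of (m, n) \<Rightarrow> of_int m + of_int n * \<tau>)" for p :: "int \<times> int" and \<tau> :: complex
  define z where "z \<tau> = of_real a + of_real b * \<tau>" for \<tau> :: complex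
  have nonint: "a \<notin> \<int> \<or> b \<notin> \<int>"
    using a b ab half_not_Ints by blast
  have w_nz: "w p \<tau> \<noteq> 0" if "p \<in> I" "Im \<tau> > 0" for p \<tau>
    using that complex_lattice.real_combination_eq_0_iff[OF complex_lattice_1, of \<tau> "of_int (fst p)" "of_int (snd p)"]
    by (auto simp: w_def I_def case_prod_unfold prod_eq_iff)
  have z_notin: "z \<tau> \<notin> lattice_of \<tau>" if "Im \<tau> > 0" for \<tau>
    using complex_lattice.real_combination_in_lattice[OF complex_lattice_1[OF that], of a b] nonint
    by (auto simp: z_def)
  have w_in: "w p \<tau> \<in> lattice_of \<tau>" for p \<tau>
    using lattice_gen_of_int[of "fst p" 1 "snd p" \<tau>] by (simp add: w_def case_prod_unfold)
  have zw: "z \<tau> \<noteq> w p \<tau>" if "Im \<tau> > 0" for \<tau> p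
    using z_notin[OF that] w_in by metis
  have z_nz: "z \<tau> \<noteq> 0" if "Im \<tau> > 0" for \<tau>
    using z_notin[OF that] by auto
  have eq: "weierstrass_zeta (lattice_of \<tau>) (z \<tau>) = 1 / z \<tau> + (\<Sum>\<^sub>\<infinity>p\<in>I. zeta_term (z \<tau>) (w p \<tau>))"
    if "Im \<tau> > 0" for \<tau>
  proof -
    interpret complex_lattice 1 \<tau>
      by (rule complex_lattice_1) fact
    have "bij_betw (\<lambda>p. w p \<tau>) I (lattice_of \<tau> - {0})"
      using bij_betw_lattice by (simp add: w_def I_def case_prod_unfold)
    then show ?thesis
      unfolding weierstrass_zeta_eq zeta_regular_part_def by (subst infsum_reindex_bij_betw) auto
  qed
  have "(\<lambda>\<tau>. \<Sum>\<^sub>\<infinity>p\<in>I. zeta_term (z \<tau>) (w p \<tau>)) holomorphic_on upper_half_plane"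
  proof (rule holomorphic_on_infsum)
    have hw: "w p holomorphic_on A" for p A
      unfolding w_def case_prod_unfold by (intro holomorphic_intros)
    show "(\<lambda>\<tau>. zeta_term (z \<tau>) (w p \<tau>)) holomorphic_on upper_half_plane" if "p \<in> I" for p
      unfolding zeta_term_def z_def
      by (intro holomorphic_intros hw)
         (use w_nz[OF that] zw[unfolded z_def] in \<open>auto simp: upper_half_plane_def\<close>)
    show "open upper_half_plane"
      by simp
    fix \<tau>0 assume "\<tau>0 \<in> upper_half_plane"
    then have pos: "Im \<tau>0 > 0"
      by (simp add: upper_half_plane_def)
    \<comment> \<open>A ball of half the height of \<open>\<tau>0\<close> stays in the region
      \<open>Im \<tau> \<ge> r\<close>, where \<open>K\<close> serves for all \<tau>.\<close>
    define r where "r = Im \<tau>0 / 2"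
    define R where "R = norm \<tau>0 + r"
    define K where "K = 1 + (1 + R) / r"
    have r: "r > 0"
      using pos by (simp add: r_def)
    have R: "R > 0"
      unfolding R_def using r by (intro add_nonneg_pos) auto
    then have K: "K > 0"
      unfolding K_def using r by (intro add_pos_nonneg) auto
    \<comment> \<open>The closed form of a term has numerator at most the square of
      \<open>1 + R\<close>, and denominator at least the square of \<open>s / K\<close> times
      \<open>s / (2 * K)\<close>; hence the factor \<open>2 * K ^ 3\<close>.\<close>
    define M where "M p = (1 + R)\<^sup>2 * 2 * K ^ 3 * (case p of (m, n) \<Rightarrow> 1 / (\<bar>real_of_int m\<bar> + \<bar>real_of_int n\<bar>) ^ 3)"
      for p :: "int \<times> int"
    have "M summable_on I"
      unfolding M_def I_def by (intro summable_on_cmult_right summable_on_int_pairs_cube)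
    moreover have "norm (zeta_term (z \<tau>) (w p \<tau>)) \<le> M p" if p: "p \<in> I" and \<tau>: "\<tau> \<in> ball \<tau>0 r" for p \<tau>
    proof -
      obtain m n where mn: "p = (m, n)"
        by (cases p)
      define s where "s = \<bar>real_of_int m\<bar> + \<bar>real_of_int n\<bar>"
      have s: "s > 0"
        using p by (auto simp: s_def I_def mn)
      have "\<bar>Im \<tau>0 - Im \<tau>\<bar> < r"
        using \<tau> abs_Im_le_cmod[of "\<tau>0 - \<tau>"] by (simp add: dist_norm)
      then have Im: "Im \<tau> \<ge> r"
        unfolding r_def by linarith
      have norm: "norm \<tau> \<le> R"
        using \<tau> norm_triangle_ineq2[of \<tau> \<tau>0] by (simp add: R_def dist_norm norm_minus_commute)
      have lower: "\<bar>x\<bar> + \<bar>y\<bar> \<le> K * norm (of_real x + of_real y * \<tau>)" for x y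
        unfolding K_def using Im r norm by (intro norm_real_combination_lower_bound)
      have 1: "s / K \<le> norm (w p \<tau>)"
        using lower[of m n] K by (simp add: s_def w_def mn field_simps)
      have "s / 2 \<le> \<bar>a - m\<bar> + \<bar>b - n\<bar>"
        using half_Ints_diff_ge[OF a, of m] half_Ints_diff_ge[OF b, of n] by (simp add: s_def field_simps)
      also have "\<dots> \<le> K * norm (of_real (a - m) + of_real (b - n) * \<tau>)"
        by (rule lower)
      also have "of_real (a - m) + of_real (b - n) * \<tau> = z \<tau> - w p \<tau>"
        by (simp add: z_def w_def mn algebra_simps)
      finally have 2: "s / (2 * K) \<le> norm (z \<tau> - w p \<tau>)"
        using K by (simp add: field_simps)
      have "norm (z \<tau>) \<le> \<bar>a\<bar> + \<bar>b\<bar> * norm \<tau>"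
        unfolding z_def by (metis norm_mult norm_of_real norm_triangle_ineq)
      also have "\<dots> \<le> 1 + 1 * R"
        using a b norm by (intro add_mono mult_mono) auto
      finally have 3: "norm (z \<tau>) \<le> 1 + R"
        by simp
      have "norm (zeta_term (z \<tau>) (w p \<tau>)) = (norm (z \<tau>))\<^sup>2 / ((norm (w p \<tau>))\<^sup>2 * norm (z \<tau> - w p \<tau>))"
        using w_nz[OF p] zw Im r by (simp add: zeta_term_eq norm_divide norm_mult norm_power)
      also have "\<dots> \<le> (1 + R)\<^sup>2 / ((s / K)\<^sup>2 * (s / (2 * K)))"
        using 1 2 3 s K R by (intro frac_le mult_mono power_mono mult_pos_pos) auto
      also have "\<dots> = M p"
        using s K by (simp add: M_def mn flip: s_def) (simp add: field_simps power2_eq_square power3_eq_cube)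
      finally show ?thesis .
    qed
    ultimately show "\<exists>M F r. r > 0 \<and> finite F \<and> M summable_on I \<and>
        (\<forall>p\<in>I - F. \<forall>\<tau>\<in>ball \<tau>0 r. norm (zeta_term (z \<tau>) (w p \<tau>)) \<le> M p)"
      using r by (intro exI[of _ M] exI[of _ "{}"] exI[of _ r]) auto
  qed
  moreover have "(\<lambda>\<tau>. 1 / z \<tau>) holomorphic_on upper_half_plane"
    using z_nz unfolding z_def by (intro holomorphic_intros) (auto simp: upper_half_plane_def)
  ultimately have "(\<lambda>\<tau>. 1 / z \<tau> + (\<Sum>\<^sub>\<infinity>p\<in>I. zeta_term (z \<tau>) (w p \<tau>))) holomorphic_on upper_half_plane"
    by (intro holomorphic_on_add)
  then show ?thesis
    by (rule holomorphic_transform) (use eq in \<open>auto simp: z_def upper_half_plane_def\<close>)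
qed

lemma weierstrass_eta_holomorphic:
  "(\<lambda>\<tau>. weierstrass_eta (lattice_of \<tau>) 1) holomorphic_on upper_half_plane"
  "(\<lambda>\<tau>. weierstrass_eta (lattice_of \<tau>) \<tau>) holomorphic_on upper_half_plane"
proof -
  have 1: "(\<lambda>\<tau>. 2 * weierstrass_zeta (lattice_of \<tau>) (of_real (1 / 2) + of_real 0 * \<tau>)) holomorphic_on upper_half_plane"
    by (intro holomorphic_intros weierstrass_zeta_half_period_holomorphic) auto
  have 2: "(\<lambda>\<tau>. 2 * weierstrass_zeta (lattice_of \<tau>) (of_real 0 + of_real (1 / 2) * \<tau>)) holomorphic_on upper_half_plane"
    by (intro holomorphic_intros weierstrass_zeta_half_period_holomorphic) auto
  have eta: "weierstrass_eta (lattice_of \<tau>) 1 = 2 * weierstrass_zeta (lattice_of \<tau>) (1 / 2)"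
    "weierstrass_eta (lattice_of \<tau>) \<tau> = 2 * weierstrass_zeta (lattice_of \<tau>) (\<tau> / 2)" if "Im \<tau> > 0" for \<tau>
    using that by (auto intro!: complex_lattice.weierstrass_eta_eq_zeta complex_lattice_1)
  show "(\<lambda>\<tau>. weierstrass_eta (lattice_of \<tau>) 1) holomorphic_on upper_half_plane"
    by (rule holomorphic_transform[OF 1]) (simp add: eta upper_half_plane_def)
  show "(\<lambda>\<tau>. weierstrass_eta (lattice_of \<tau>) \<tau>) holomorphic_on upper_half_plane"
    by (rule holomorphic_transform[OF 2]) (simp add: eta upper_half_plane_def)
qed

section \<open>Quasi-periods\<close>

lemma eventually_not_pole_meromorphic:
  assumes "f meromorphic_on A" "z \<in> A"
  shows "\<forall>\<^sub>F w in at z. \<not> is_pole f w"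
  using assms eventually_not_pole meromorphic_on_altdef by blast

lemma exists_not_pole_meromorphic:
  assumes "f meromorphic_on UNIV"
  obtains z where "\<not> is_pole f z"
  using eventually_happens'[OF _ eventually_not_pole_meromorphic[OF assms, of 0]] by (auto simp: at_neq_bot)

text \<open>A quasi-period law speaks only about regular points, so composing two of them requires
  that translation by \<omega> keep a regular point regular. Near \<open>z\<close>, the translate of
  \<open>f\<close> differs from \<open>f\<close> by a constant.\<close>

lemma is_pole_minus_period:
  assumes "f meromorphic_on UNIV" "is_quasi_period f \<omega> h" "is_pole f (z + \<omega>)"
  shows "is_pole f z"
proof -
  have "is_pole (f \<circ> (+) \<omega>) z"
    using assms(3) by (simp add: is_pole_shift_iff)
  moreover have "\<forall>\<^sub>F w in at z. (f \<circ> (+) \<omega>) w = f w + h"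
    using eventually_not_pole_meromorphic[OF assms(1) UNIV_I]
    by eventually_elim (use assms(2) in \<open>auto simp: is_quasi_period_def add.commute\<close>)
  ultimately have "is_pole (\<lambda>w. f w + h) z"
    by (rule is_pole_transform) simp
  then show ?thesis
    using is_pole_plus_const_iff by blast
qed

lemma is_quasi_period_add:
  assumes "f meromorphic_on UNIV" "is_quasi_period f \<omega> h" "is_quasi_period f \<omega>' h'"
  shows "is_quasi_period f (\<omega> + \<omega>') (h + h')"
  unfolding is_quasi_period_def
proof safe
  fix z assume "\<not> is_pole f z"
  moreover from this have "\<not> is_pole f (z + \<omega>)"
    using is_pole_minus_period[OF assms(1,2)] by blast
  ultimately show "f (z + (\<omega> + \<omega>')) = f z + (h + h')"
    using assms(2,3) unfolding is_quasi_period_def by (simp flip: add.assoc)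
qed

lemma quasi_period_eqI_meromorphic:
  assumes "f meromorphic_on UNIV" "is_quasi_period f \<omega> h"
  shows "quasi_period f \<omega> = h"
  using exists_not_pole_meromorphic[OF assms(1)] quasi_period_eqI[OF assms(2)] by blast

lemma is_quasi_period_quasi_period:
  assumes "f meromorphic_on UNIV" "\<exists>h. is_quasi_period f \<omega> h"
  shows "is_quasi_period f \<omega> (quasi_period f \<omega>)"
  using assms quasi_period_eqI_meromorphic by blast

lemma quasi_period_add:
  assumes "f meromorphic_on UNIV" "\<exists>h. is_quasi_period f \<omega> h" "\<exists>h. is_quasi_period f \<omega>' h"
  shows "quasi_period f (\<omega> + \<omega>') = quasi_period f \<omega> + quasi_period f \<omega>'"
  using assms by (intro quasi_period_eqI_meromorphic is_quasi_period_add is_quasi_period_quasi_period)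

lemma additive_lattice_gen_eq_0:
  fixes F :: "complex \<Rightarrow> complex"
  assumes add: "\<And>x y. x \<in> lattice_gen a b \<Longrightarrow> y \<in> lattice_gen a b \<Longrightarrow> F (x + y) = F x + F y"
    and "F a = 0" "F b = 0" "\<omega> \<in> lattice_gen a b"
  shows "F \<omega> = 0"
proof -
  \<comment> \<open>Extension by 0 turns additivity with vanishing values at \<open>a\<close> and
    \<open>b\<close> into periodicity on the whole plane, so \<open>periodic_lattice_gen\<close>
    supplies the integer induction.\<close>
  define G where "G z = (if z \<in> lattice_gen a b then F z else 0)" for z
  have "G (0 + \<omega>) = G 0"
  proof (rule periodic_lattice_gen)
    show "G (z + a) = G z" "G (z + b) = G z" for z
      using assms(1-3) by (simp_all add: G_def lattice_gen_add_iff)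
  qed fact
  then show ?thesis
    using add[of 0 0] assms(4) by (simp add: G_def)
qed

lemma matrix_inv_vector_eqI:
  fixes M :: "'a::field ^ 'n ^ 'n"
  assumes "det M \<noteq> 0" "M *v v = w"
  shows "matrix_inv M *v w = v"
proof -
  have "\<exists>B. M ** B = mat 1 \<and> B ** M = mat 1"
    using assms(1) by (simp add: invertible_det_nz flip: invertible_def)
  then have "M ** matrix_inv M = mat 1 \<and> matrix_inv M ** M = mat 1"
    unfolding matrix_inv_def by (rule someI_ex)
  then show ?thesis
    using assms(2) by (metis matrix_vector_mul_assoc matrix_vector_mul_lid)
qed

text \<open>The hypothesis holds on the whole lattice, hence at each oriented basis, where
  \<open>legendre_nonzero\<close> makes the matrix invertible. All bases therefore give the same
  vector, and the definite description is meaningful.\<close>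

lemma Phi_Psi_eqI:
  assumes \<tau>: "Im \<tau> > 0"
    and H: "\<And>\<omega>. \<omega> \<in> lattice_of \<tau> \<Longrightarrow>
              quasi_period (\<Z> (lattice_of \<tau>)) \<omega> = \<phi> * \<omega> + \<psi> * weierstrass_eta (lattice_of \<tau>) \<omega>"
  shows "Phi \<Z> (lattice_of \<tau>) = \<phi>" "Psi \<Z> (lattice_of \<tau>) = \<psi>"
proof -
  let ?\<Lambda> = "lattice_of \<tau>"
  define v :: "complex ^ 2" where "v = vector [\<phi>, \<psi>]"
  have basis: "PhiPsi_basis \<Z> ?\<Lambda> \<omega>1 \<omega>2 = v" if "oriented_basis ?\<Lambda> \<omega>1 \<omega>2" for \<omega>1 \<omega>2
  proof -
    from that interpret complex_lattice \<omega>1 \<omega>2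
      by unfold_locales (simp add: oriented_basis_def)
    have \<Lambda>: "?\<Lambda> = lattice_gen \<omega>1 \<omega>2"
      using that by (simp add: oriented_basis_def)
    show ?thesis
      unfolding PhiPsi_basis_def
    proof (rule matrix_inv_vector_eqI)
      show "det (vector [vector [\<omega>2, weierstrass_eta ?\<Lambda> \<omega>2],
               vector [\<omega>1, weierstrass_eta ?\<Lambda> \<omega>1]] :: complex ^ 2 ^ 2) \<noteq> 0"
        using legendre_nonzero by (simp add: det_2 \<Lambda> mult.commute)
      show "(vector [vector [\<omega>2, weierstrass_eta ?\<Lambda> \<omega>2],
               vector [\<omega>1, weierstrass_eta ?\<Lambda> \<omega>1]] :: complex ^ 2 ^ 2) *v v
          = vector [quasi_period (\<Z> ?\<Lambda>) \<omega>2, quasi_period (\<Z> ?\<Lambda>) \<omega>1]"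
        using H[of \<omega>1] H[of \<omega>2]
        by (simp add: \<Lambda> v_def vec_eq_iff forall_2 matrix_vector_mult_def sum_2 mult.commute)
    qed
  qed
  have "oriented_basis ?\<Lambda> 1 \<tau>"
    using \<tau> by (simp add: oriented_basis_def)
  then have "PhiPsi \<Z> ?\<Lambda> = v"
    unfolding PhiPsi_def using basis by (intro the_equality) auto
  then show "Phi \<Z> ?\<Lambda> = \<phi>" "Psi \<Z> ?\<Lambda> = \<psi>"
    by (simp_all add: Phi_def Psi_def v_def)
qed

text \<open>Cramer's rule at 1 and \<tau> yields candidates. Both sides of the last equation are
  additive in \<omega>, so agreement at the generators spreads to the lattice, which is what
  \<open>Phi_Psi_eqI\<close> asks for.\<close>

lemma Phi_Psi_formulas:
  assumes \<tau>: "Im \<tau> > 0" and mero: "\<Z> (lattice_of \<tau>) meromorphic_on UNIV"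
    and ex: "\<And>\<omega>. \<omega> \<in> lattice_of \<tau> \<Longrightarrow> \<exists>h. is_quasi_period (\<Z> (lattice_of \<tau>)) \<omega> h"
  defines "H \<equiv> quasi_period (\<Z> (lattice_of \<tau>))" and "\<eta> \<equiv> weierstrass_eta (lattice_of \<tau>)"
  shows Phi_formula: "Phi \<Z> (lattice_of \<tau>) = (\<eta> 1 * H \<tau> - \<eta> \<tau> * H 1) / (\<tau> * \<eta> 1 - \<eta> \<tau>)"
    and Psi_formula: "Psi \<Z> (lattice_of \<tau>) = (\<tau> * H 1 - H \<tau>) / (\<tau> * \<eta> 1 - \<eta> \<tau>)"
    and quasi_period_eq_Phi_Psi: "\<And>\<omega>. \<omega> \<in> lattice_of \<tau> \<Longrightarrow>
          H \<omega> = Phi \<Z> (lattice_of \<tau>) * \<omega> + Psi \<Z> (lattice_of \<tau>) * \<eta> \<omega>"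
proof -
  interpret complex_lattice 1 \<tau>
    by (rule complex_lattice_1) fact
  define D where "D = \<tau> * \<eta> 1 - \<eta> \<tau>"
  have D: "D \<noteq> 0"
    using legendre_nonzero by (simp add: D_def \<eta>_def)
  define \<phi> where "\<phi> = (\<eta> 1 * H \<tau> - \<eta> \<tau> * H 1) / D"
  define \<psi> where "\<psi> = (\<tau> * H 1 - H \<tau>) / D"
  have *: "\<phi> * D = \<eta> 1 * H \<tau> - \<eta> \<tau> * H 1" "\<psi> * D = \<tau> * H 1 - H \<tau>"
    using D by (simp_all add: \<phi>_def \<psi>_def)
  have "(\<phi> * 1 + \<psi> * \<eta> 1) * D = H 1 * D" "(\<phi> * \<tau> + \<psi> * \<eta> \<tau>) * D = H \<tau> * D"
    using * unfolding D_def by algebra+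
  then have gen: "\<phi> * 1 + \<psi> * \<eta> 1 = H 1" "\<phi> * \<tau> + \<psi> * \<eta> \<tau> = H \<tau>"
    using D by simp_all
  have lin: "H \<omega> = \<phi> * \<omega> + \<psi> * \<eta> \<omega>" if "\<omega> \<in> lattice_of \<tau>" for \<omega>
  proof -
    have "H \<omega> - (\<phi> * \<omega> + \<psi> * \<eta> \<omega>) = 0"
    proof (rule additive_lattice_gen_eq_0[where F = "\<lambda>\<omega>. H \<omega> - (\<phi> * \<omega> + \<psi> * \<eta> \<omega>)"])
      fix x y assume xy: "x \<in> lattice_of \<tau>" "y \<in> lattice_of \<tau>"
      have "H (x + y) = H x + H y"
        unfolding H_def using mero ex xy by (intro quasi_period_add) auto
      moreover have "\<eta> (x + y) = \<eta> x + \<eta> y"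
        unfolding \<eta>_def using xy by (rule weierstrass_eta_add)
      ultimately show "H (x + y) - (\<phi> * (x + y) + \<psi> * \<eta> (x + y)) =
          H x - (\<phi> * x + \<psi> * \<eta> x) + (H y - (\<phi> * y + \<psi> * \<eta> y))"
        by (simp add: algebra_simps)
    qed (use gen that in auto)
    then show ?thesis
      by simp
  qed
  have eqs: "Phi \<Z> (lattice_of \<tau>) = \<phi>" "Psi \<Z> (lattice_of \<tau>) = \<psi>"
    using Phi_Psi_eqI[OF \<tau>, of \<Z> \<phi> \<psi>] lin by (simp_all add: H_def \<eta>_def)
  show "Phi \<Z> (lattice_of \<tau>) = (\<eta> 1 * H \<tau> - \<eta> \<tau> * H 1) / (\<tau> * \<eta> 1 - \<eta> \<tau>)"
    "Psi \<Z> (lattice_of \<tau>) = (\<tau> * H 1 - H \<tau>) / (\<tau> * \<eta> 1 - \<eta> \<tau>)"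
    by (simp_all add: eqs \<phi>_def \<psi>_def D_def)
  show "H \<omega> = Phi \<Z> (lattice_of \<tau>) * \<omega> + Psi \<Z> (lattice_of \<tau>) * \<eta> \<omega>" if "\<omega> \<in> lattice_of \<tau>" for \<omega>
    using lin[OF that] by (simp add: eqs)
qed

text \<open>A local homeomorphism maps punctured neighbourhoods to punctured neighbourhoods. Poles
  and \<open>remove_sings\<close> can thus be transported along scalings and Moebius maps.\<close>

lemma filtermap_at_inverse:
  fixes f g :: "complex \<Rightarrow> complex"
  assumes "isCont f z" "isCont g (f z)"
    and gf: "\<forall>\<^sub>F w in nhds z. g (f w) = w" and fg: "\<forall>\<^sub>F w in nhds (f z). f (g w) = w"
  shows "filtermap f (at z) = at (f z)"
proof (rule filtermap_fun_inverse)
  have z: "g (f z) = z"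
    using eventually_nhds_x_imp_x[OF gf] .
  have gf': "\<forall>\<^sub>F w in at z. g (f w) = w" and fg': "\<forall>\<^sub>F w in at (f z). f (g w) = w"
    using gf fg by (auto simp: eventually_at_filter elim: eventually_mono)
  have ne: "\<forall>\<^sub>F w in at x. w \<noteq> x" for x :: complex
    by (simp add: eventually_at_filter)
  have "\<forall>\<^sub>F w in at z. f w \<noteq> f z"
    using gf' ne by eventually_elim (use z in auto)
  then show "filterlim f (at (f z)) (at z)"
    using assms(1) by (simp add: filterlim_at isCont_def)
  have "\<forall>\<^sub>F w in at (f z). g w \<noteq> z"
    using fg' ne by eventually_elim auto
  then show "filterlim g (at z) (at (f z))"
    using assms(2) z by (simp add: filterlim_at isCont_def)
  show "\<forall>\<^sub>F w in at (f z). f (g w) = w"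
    by (rule fg')
qed

section \<open>Homogeneity under scaling of the lattice\<close>

lemma filtermap_mult_at:
  assumes "\<alpha> \<noteq> 0"
  shows "filtermap (\<lambda>w. \<alpha> * w) (at z) = at (\<alpha> * z :: complex)"
  by (rule filtermap_at_inverse[where g = "\<lambda>w. w / \<alpha>"]) (use assms in \<open>auto intro!: continuous_intros\<close>)

lemma quasi_period_scale:
  assumes "\<alpha> \<noteq> 0" "c \<noteq> 0" and F: "\<And>z. F (\<alpha> * z) = c * f z"
    and mero: "f meromorphic_on UNIV" and per: "is_quasi_period f \<omega> h"
  shows "quasi_period F (\<alpha> * \<omega>) = c * h"
proof -
  have pole: "is_pole F (\<alpha> * z) \<longleftrightarrow> is_pole f z" for z
    using is_pole_compose_iff[OF filtermap_mult_at[OF \<open>\<alpha> \<noteq> 0\<close>], of F z] \<open>c \<noteq> 0\<close> by (simp add: o_def F)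
  have "is_quasi_period F (\<alpha> * \<omega>) (c * h)"
    unfolding is_quasi_period_def
  proof safe
    fix z assume z: "\<not> is_pole F z"
    define w where "w = z / \<alpha>"
    have zw: "z = \<alpha> * w"
      using \<open>\<alpha> \<noteq> 0\<close> by (simp add: w_def)
    have "F (\<alpha> * (w + \<omega>)) = F (\<alpha> * w) + c * h"
      using z pole per unfolding zw is_quasi_period_def F by (simp add: distrib_left)
    then show "F (z + \<alpha> * \<omega>) = F z + c * h"
      by (simp add: zw distrib_left)
  qed
  moreover obtain z where "\<not> is_pole f z"
    using exists_not_pole_meromorphic[OF mero] by blast
  ultimately show ?thesis
    using quasi_period_eqI pole by blast
qed

text \<open>Every summand is homogeneous of degree \<open>- 1\<close>, division by zero included, so
  the law holds at poles as well.\<close>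

lemma weierstrass_zeta_scale:
  assumes "\<alpha> \<noteq> 0"
  shows "weierstrass_zeta ((*) \<alpha> ` \<Lambda>) (\<alpha> * z) = inverse \<alpha> * weierstrass_zeta \<Lambda> z"
proof -
  have eq: "(*) \<alpha> ` \<Lambda> - {0} = (*) \<alpha> ` (\<Lambda> - {0})"
    using assms by auto
  have t: "1 / (\<alpha> * z - \<alpha> * \<omega>) + 1 / (\<alpha> * \<omega>) + \<alpha> * z / (\<alpha> * \<omega>)\<^sup>2
      = inverse \<alpha> * (1 / (z - \<omega>) + 1 / \<omega> + z / \<omega>\<^sup>2)" for \<omega>
  proof -
    have "\<alpha> * z - \<alpha> * \<omega> = \<alpha> * (z - \<omega>)" "\<alpha> * z / (\<alpha> * \<omega>)\<^sup>2 = inverse \<alpha> * (z / \<omega>\<^sup>2)"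
      using assms by (simp_all add: right_diff_distrib power2_eq_square divide_inverse)
    then show ?thesis
      by (simp add: distrib_left divide_inverse)
  qed
  have "weierstrass_zeta ((*) \<alpha> ` \<Lambda>) (\<alpha> * z) =
      1 / (\<alpha> * z) + (\<Sum>\<^sub>\<infinity>\<omega>\<in>\<Lambda> - {0}. inverse \<alpha> * (1 / (z - \<omega>) + 1 / \<omega> + z / \<omega>\<^sup>2))"
    unfolding weierstrass_zeta_def eq
    using assms by (subst infsum_reindex) (auto simp: inj_on_def o_def t)
  also have "\<dots> = inverse \<alpha> * weierstrass_zeta \<Lambda> z"
    by (subst infsum_cmult_right') (simp add: weierstrass_zeta_def distrib_left divide_inverse)
  finally show ?thesis .
qed

lemma scaled_lattice_of: "(*) \<alpha> ` lattice_of \<tau> = lattice_gen \<alpha> (\<alpha> * \<tau>)"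
proof (intro equalityI subsetI)
  fix x assume "x \<in> (*) \<alpha> ` lattice_of \<tau>"
  then obtain m n where "x = \<alpha> * (of_int m * 1 + of_int n * \<tau>)"
    unfolding lattice_gen_def by blast
  then have "x = of_int m * \<alpha> + of_int n * (\<alpha> * \<tau>)"
    by (simp add: algebra_simps)
  then show "x \<in> lattice_gen \<alpha> (\<alpha> * \<tau>)"
    using lattice_gen_of_int by metis
next
  fix x assume "x \<in> lattice_gen \<alpha> (\<alpha> * \<tau>)"
  then obtain m n where "x = of_int m * \<alpha> + of_int n * (\<alpha> * \<tau>)"
    by (elim lattice_genE)
  then have "x = \<alpha> * (of_int m * 1 + of_int n * \<tau>)"
    by (simp add: algebra_simps)
  then show "x \<in> (*) \<alpha> ` lattice_of \<tau>"
    using lattice_gen_of_int by (metis imageI)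
qed

context complex_lattice
begin

text \<open>At a lattice point \<omega> the bare formula evaluates to
  \<open>c * \<omega> + weierstrass_eta L \<omega>\<close>, in general not the 0 that the normal
  form demands at a pole; hence the case distinction.\<close>

lemma nicely_meromorphic_linear_plus_zeta:
  "(\<lambda>z. if z \<in> L then 0 else c * z + weierstrass_zeta L z) nicely_meromorphic_on UNIV"
    (is "?Z nicely_meromorphic_on UNIV")
  and is_pole_linear_plus_zeta: "z \<in> L \<Longrightarrow> is_pole (\<lambda>z. if z \<in> L then 0 else c * z + weierstrass_zeta L z) z"
proof -
  have opn: "open (- L)"
    using closed_subset_lattice[OF order_refl] by auto
  have hol: "?Z holomorphic_on - L"
    by (rule holomorphic_transform[of "\<lambda>z. c * z + weierstrass_zeta L z"])
       (auto intro!: holomorphic_intros holomorphic_weierstrass_zeta)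
  show pole: "is_pole ?Z z" if "z \<in> L" for z
  proof -
    have "((\<lambda>z. c * z) \<longlongrightarrow> c * z) (at z)"
      by (intro tendsto_intros)
    then have "is_pole (\<lambda>z. c * z + weierstrass_zeta L z) z"
      using that is_pole_weierstrass_zeta_iff unfolding is_pole_def
      by (blast intro: tendsto_add_filterlim_at_infinity)
    moreover have "\<forall>\<^sub>F z in at z. c * z + weierstrass_zeta L z = ?Z z"
      using eventually_notin_lattice by eventually_elim simp
    ultimately show ?thesis
      by (rule is_pole_transform) simp
  qed
  have iso: "isolated_singularity_at ?Z z" for z
  proof -
    obtain r where r: "r > 0" "ball z r - {z} \<subseteq> - L"
      using eventually_notin_lattice[of z] unfolding eventually_at by (auto simp: subset_iff dist_commute)
    have "?Z analytic_on ball z r - {z}"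
      using analytic_on_open[of "ball z r - {z}"] holomorphic_on_subset[OF hol r(2)] by (simp add: open_delete)
    then show ?thesis
      using r(1) by (auto simp: isolated_singularity_at_def)
  qed
  show "?Z nicely_meromorphic_on UNIV"
  proof (rule nicely_meromorphic_onI_open[where pts = L])
    show "?Z analytic_on UNIV - L"
      using hol opn by (simp add: analytic_on_open flip: Compl_eq_Diff_UNIV)
    show "is_pole ?Z z \<and> ?Z z = 0" if "z \<in> L" for z
      using pole[OF that] that by simp
  qed (use iso in auto)
qed

lemma quasi_period_linear_plus_zeta:
  assumes "\<omega> \<in> L"
  shows "is_quasi_period (\<lambda>z. if z \<in> L then 0 else c * z + weierstrass_zeta L z) \<omega>
           (c * \<omega> + weierstrass_eta L \<omega>)"
  unfolding is_quasi_period_def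
  using is_pole_linear_plus_zeta[of _ c] assms
  by (auto simp: lattice_gen_add_iff weierstrass_zeta_add_period algebra_simps)

lemma meromorphic_weierstrass_zeta: "weierstrass_zeta L meromorphic_on UNIV"
proof -
  have "(\<lambda>z. if z \<in> L then 0 else 0 * z + weierstrass_zeta L z) meromorphic_on UNIV"
    using nicely_meromorphic_linear_plus_zeta unfolding nicely_meromorphic_on_def by blast
  also have "?this \<longleftrightarrow> ?thesis"
  proof (rule meromorphic_on_cong)
    show "\<forall>\<^sub>F w in at z. (if w \<in> L then 0 else 0 * w + weierstrass_zeta L w) = weierstrass_zeta L w" for z
      using eventually_notin_lattice by eventually_elim simp
  qed simp
  finally show ?thesis .
qed

lemma weierstrass_eta_scale:
  assumes "\<alpha> \<noteq> 0" "\<omega> \<in> L"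
  shows "weierstrass_eta ((*) \<alpha> ` L) (\<alpha> * \<omega>) = inverse \<alpha> * weierstrass_eta L \<omega>"
proof -
  have "is_quasi_period (weierstrass_zeta L) \<omega> (weierstrass_eta L \<omega>)"
    using assms(2) by (simp add: is_quasi_period_def weierstrass_zeta_add_period)
  then show ?thesis
    unfolding weierstrass_eta_def[of "(*) \<alpha> ` L"]
    using assms(1) by (intro quasi_period_scale[OF _ _ _ meromorphic_weierstrass_zeta] weierstrass_zeta_scale) auto
qed

end

section \<open>Modular transformations\<close>

locale modular_matrix =
  fixes a b c d :: int
  assumes det: "a * d - b * c = 1"
begin

definition factor :: "complex \<Rightarrow> complex" where
  "factor \<tau> = of_int c * \<tau> + of_int d"

lemma factor_nonzero:
  assumes "Im \<tau> > 0"
  shows "factor \<tau> \<noteq> 0"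
proof
  assume "factor \<tau> = 0"
  then have *: "of_int d + of_int c * \<tau> = 0"
    by (simp add: factor_def add.commute)
  then have "d = 0 \<and> c = 0"
    using complex_lattice.real_combination_eq_0_iff[OF complex_lattice_1[OF assms], of "of_int d" "of_int c"]
    by simp
  then show False
    using det by simp
qed

lemma det_complex: "of_int a * of_int d - of_int b * of_int c = (1 :: complex)"
  using det by (metis of_int_1 of_int_diff of_int_mult)

lemma factor_mult_mobius: "Im \<tau> > 0 \<Longrightarrow> factor \<tau> * mobius a b c d \<tau> = of_int a * \<tau> + of_int b"
  using factor_nonzero by (simp add: mobius_def factor_def)

lemma Im_mobius_pos:
  assumes "Im \<tau> > 0"
  shows "Im (mobius a b c d \<tau>) > 0"
proof -
  have "Im ((of_int a * \<tau> + of_int b) * cnj (factor \<tau>)) = of_int (a * d - b * c) * Im \<tau>"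
    by (simp add: factor_def algebra_simps)
  then have "Im ((of_int a * \<tau> + of_int b) * cnj (factor \<tau>)) = Im \<tau>"
    by (simp add: det)
  moreover have "mobius a b c d \<tau> = (of_int a * \<tau> + of_int b) * cnj (factor \<tau>) / of_real ((norm (factor \<tau>))\<^sup>2)"
    unfolding mobius_def factor_def[symmetric] by (rule complex_div_cnj)
  ultimately have "Im (mobius a b c d \<tau>) = Im \<tau> / (norm (factor \<tau>))\<^sup>2"
    by (simp only: Im_divide_of_real)
  then show ?thesis
    using assms factor_nonzero[OF assms] by simp
qed

lemma mobius_inverse:
  assumes "Im \<tau> > 0"
  shows "mobius d (- b) (- c) a (mobius a b c d \<tau>) = \<tau>"
proof -
  define u where "u = factor \<tau>"
  define m where "m = mobius a b c d \<tau>"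
  have u: "u \<noteq> 0" "u * m = of_int a * \<tau> + of_int b" "u = of_int c * \<tau> + of_int d"
    using factor_nonzero[OF assms] factor_mult_mobius[OF assms] by (auto simp: u_def m_def factor_def)
  have 1: "u * (of_int d * m - of_int b) = \<tau>"
    using u(2,3) det_complex by algebra
  have 2: "u * (- of_int c * m + of_int a) = 1"
    using u(2,3) det_complex by algebra
  have "mobius d (- b) (- c) a m = (u * (of_int d * m - of_int b)) / (u * (- of_int c * m + of_int a))"
    using u(1) by (simp add: mobius_def)
  then show ?thesis
    unfolding 1 2 by (simp add: m_def)
qed

lemma lattice_of_mobius:
  assumes "Im \<tau> > 0"
  shows "(*) (factor \<tau>) ` lattice_of (mobius a b c d \<tau>) = lattice_of \<tau>"
proof -
  define u where "u = factor \<tau>"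
  define m where "m = mobius a b c d \<tau>"
  have u: "u * m = of_int a * \<tau> + of_int b" "u = of_int c * \<tau> + of_int d"
    using factor_mult_mobius[OF assms] by (auto simp: u_def m_def factor_def)
  have "lattice_gen u (u * m) = lattice_gen 1 \<tau>"
  proof (intro equalityI subsetI)
    fix x assume "x \<in> lattice_gen u (u * m)"
    then obtain p q where "x = of_int p * u + of_int q * (u * m)"
      by (elim lattice_genE)
    then have "x = of_int (p * d + q * b) * 1 + of_int (p * c + q * a) * \<tau>"
      unfolding u(1) unfolding u(2) by (simp add: algebra_simps)
    then show "x \<in> lattice_gen 1 \<tau>"
      using lattice_gen_of_int by metis
  next
    fix x assume "x \<in> lattice_gen 1 \<tau>"
    then obtain p q where x: "x = of_int p * 1 + of_int q * \<tau>"
      by (elim lattice_genE)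
    \<comment> \<open>The coefficients come from the inverse matrix, with entries \<open>d\<close>,
      \<open>- b\<close>, \<open>- c\<close>, \<open>a\<close>.\<close>
    have "of_int (a * p - b * q) * u + of_int (d * q - c * p) * (u * m) = x"
      unfolding u(1) unfolding u(2) x of_int_diff of_int_mult using det_complex by algebra
    then show "x \<in> lattice_gen u (u * m)"
      using lattice_gen_of_int by metis
  qed
  then show ?thesis
    by (simp add: scaled_lattice_of u_def m_def)
qed

lemma isCont_mobius: "Im \<tau> > 0 \<Longrightarrow> isCont (mobius a b c d) \<tau>"
  unfolding mobius_def[abs_def] using factor_nonzero by (intro continuous_intros) (simp add: factor_def)

lemma filtermap_mobius_at:
  assumes "Im \<tau> > 0"
  shows "filtermap (mobius a b c d) (at \<tau>) = at (mobius a b c d \<tau>)"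
proof -
  interpret inv: modular_matrix d "- b" "- c" a
    using det by unfold_locales (simp add: mult.commute)
  have ev: "\<forall>\<^sub>F w in nhds x. Im w > 0" if "Im x > 0" for x
    using eventually_nhds_in_open[OF open_upper_half_plane, of x] that by (simp add: upper_half_plane_def)
  show ?thesis
  proof (rule filtermap_at_inverse[where g = "mobius d (- b) (- c) a"])
    show "\<forall>\<^sub>F w in nhds \<tau>. mobius d (- b) (- c) a (mobius a b c d w) = w"
      using ev[OF assms] by eventually_elim (rule mobius_inverse)
    show "\<forall>\<^sub>F w in nhds (mobius a b c d \<tau>). mobius a b c d (mobius d (- b) (- c) a w) = w"
      using ev[OF Im_mobius_pos[OF assms]] by eventually_elim (use inv.mobius_inverse in simp)
  qed (use assms isCont_mobius inv.isCont_mobius Im_mobius_pos in auto)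
qed

end

text \<open>A continuous factor that is nonzero at \<open>z\<close> preserves both existence and
  non-existence of a limit. In the latter case both sides are the default value 0, so poles are
  covered.\<close>

lemma remove_sings_mult:
  assumes u: "isCont u z" "u z \<noteq> 0"
  shows "remove_sings (\<lambda>w. u w * f w) z = u z * remove_sings f z"
proof (cases "\<exists>c. f \<midarrow>z\<rightarrow> c")
  case True
  then obtain c where "f \<midarrow>z\<rightarrow> c"
    by blast
  moreover from this have "(\<lambda>w. u w * f w) \<midarrow>z\<rightarrow> u z * c"
    using u by (intro tendsto_intros) (simp_all add: isCont_def)
  ultimately show ?thesis
    by (simp add: remove_sings_eqI)
next
  case False
  have "\<not> (\<exists>c. (\<lambda>w. u w * f w) \<midarrow>z\<rightarrow> c)"
  proof safe
    fix c assume "(\<lambda>w. u w * f w) \<midarrow>z\<rightarrow> c"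
    then have "(\<lambda>w. u w * f w / u w) \<midarrow>z\<rightarrow> c / u z"
      using u by (intro tendsto_intros) (simp_all add: isCont_def)
    moreover have "\<forall>\<^sub>F w in at z. u w * f w / u w = f w"
      using tendsto_imp_eventually_ne[of u "u z" "at z" 0] u
      by (auto simp: isCont_def elim: eventually_mono)
    ultimately have "f \<midarrow>z\<rightarrow> c / u z"
      using tendsto_cong by fast
    with False show False
      by blast
  qed
  with False show ?thesis
    by (simp add: remove_sings_def)
qed

section \<open>The quotient as a meromorphic modular form\<close>

lemma upper_half_plane_iff [simp]: "\<tau> \<in> upper_half_plane \<longleftrightarrow> Im \<tau> > 0"
  by (simp add: upper_half_plane_def)

text \<open>Discreteness handles points of \<open>S\<close>, relative closedness the others.
  Formulas valid off \<open>S\<close> thus hold on a punctured neighbourhood of each point of the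
  half-plane.\<close>

lemma exceptional_set_eventually_notin:
  assumes "exceptional_set S" "Im \<tau> > 0"
  shows "\<forall>\<^sub>F w in at \<tau>. w \<in> upper_half_plane - S"
proof -
  have cl: "closedin (top_of_set upper_half_plane) S" and disc: "discrete S"
    using assms(1) by (auto simp: exceptional_set_def)
  have "\<forall>\<^sub>F w in at \<tau>. w \<notin> S"
  proof (cases "\<tau> \<in> S")
    case True
    then show ?thesis
      using disc by (auto simp: discrete_def isolated_in_altdef)
  next
    case False
    have "\<not> \<tau> islimpt S"
      using cl False assms(2) by (auto simp: closedin_limpt)
    then show ?thesis
      by (simp add: islimpt_iff_eventually)
  qed
  moreover have "\<forall>\<^sub>F w in at \<tau>. w \<in> upper_half_plane"
    using assms(2) by (intro eventually_at_in_open') auto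
  ultimately show ?thesis
    by eventually_elim simp
qed

lemma elliptic_zetaD:
  assumes Z: "elliptic_zeta k S \<Z>" and "\<tau> \<in> upper_half_plane - S"
  shows "\<Z> (lattice_of \<tau>) meromorphic_on UNIV"
    and "\<And>\<omega>. \<omega> \<in> lattice_of \<tau> \<Longrightarrow> \<exists>h. is_quasi_period (\<Z> (lattice_of \<tau>)) \<omega> h"
    and "\<And>\<alpha> z. \<alpha> \<noteq> 0 \<Longrightarrow> \<Z> ((*) \<alpha> ` lattice_of \<tau>) (\<alpha> * z) = \<alpha> powi k * \<Z> (lattice_of \<tau>) z"
proof -
  have "(*) 1 ` lattice_of \<tau> \<in> regular_lattices S"
    unfolding regular_lattices_def using assms(2) by (intro CollectI exI[of _ 1] exI[of _ \<tau>]) auto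
  then have "lattice_of \<tau> \<in> regular_lattices S"
    by simp
  then show "\<Z> (lattice_of \<tau>) meromorphic_on UNIV"
    and "\<And>\<omega>. \<omega> \<in> lattice_of \<tau> \<Longrightarrow> \<exists>h. is_quasi_period (\<Z> (lattice_of \<tau>)) \<omega> h"
    and "\<And>\<alpha> z. \<alpha> \<noteq> 0 \<Longrightarrow> \<Z> ((*) \<alpha> ` lattice_of \<tau>) (\<alpha> * z) = \<alpha> powi k * \<Z> (lattice_of \<tau>) z"
    using Z unfolding elliptic_zeta_def nicely_meromorphic_on_def by blast+
qed

lemma Phi_over_Psi_meromorphic:
  assumes Z: "elliptic_zeta k S \<Z>"
  shows "Phi_over_Psi \<Z> meromorphic_on upper_half_plane"
proof -
  define H where "H \<tau> = quasi_period (\<Z> (lattice_of \<tau>))" for \<tau>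
  define \<eta> where "\<eta> \<tau> = weierstrass_eta (lattice_of \<tau>)" for \<tau>
  define D where "D \<tau> = \<tau> * \<eta> \<tau> 1 - \<eta> \<tau> \<tau>" for \<tau>
  have H: "(\<lambda>\<tau>. H \<tau> \<tau>) meromorphic_on upper_half_plane" "(\<lambda>\<tau>. H \<tau> 1) meromorphic_on upper_half_plane"
    using Z by (simp_all add: elliptic_zeta_def H_def)
  have \<eta>: "(\<lambda>\<tau>. \<eta> \<tau> \<tau>) meromorphic_on upper_half_plane" "(\<lambda>\<tau>. \<eta> \<tau> 1) meromorphic_on upper_half_plane"
    unfolding \<eta>_def using weierstrass_eta_holomorphic
    by (auto intro!: analytic_on_imp_meromorphic_on simp: analytic_on_open)
  have D: "D meromorphic_on upper_half_plane"
    unfolding D_def by (intro meromorphic_intros \<eta>)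
  have "(\<lambda>\<tau>. ((\<eta> \<tau> 1 * H \<tau> \<tau> - \<eta> \<tau> \<tau> * H \<tau> 1) / D \<tau>) / ((\<tau> * H \<tau> 1 - H \<tau> \<tau>) / D \<tau>))
          meromorphic_on upper_half_plane"
    by (intro meromorphic_intros H \<eta> D)
  also have "?this \<longleftrightarrow> ?thesis"
  proof (rule meromorphic_on_cong)
    fix \<tau> assume "\<tau> \<in> upper_half_plane"
    then have "\<forall>\<^sub>F w in at \<tau>. w \<in> upper_half_plane - S"
      using Z by (intro exceptional_set_eventually_notin) (auto simp: elliptic_zeta_def)
    then show "\<forall>\<^sub>F w in at \<tau>. ((\<eta> w 1 * H w w - \<eta> w w * H w 1) / D w) / ((w * H w 1 - H w w) / D w)
        = Phi_over_Psi \<Z> w"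
    proof eventually_elim
      case (elim w)
      then show ?case
        using Phi_formula[of w \<Z>] Psi_formula[of w \<Z>] elliptic_zetaD(1,2)[OF Z elim]
        by (simp add: Phi_over_Psi_def H_def \<eta>_def D_def)
    qed
  qed simp
  finally show ?thesis .
qed

context modular_matrix
begin

text \<open>Comparing coefficients of \<omega> and \<eta> shows that \<Phi> has weight
  \<open>k - 1\<close> and \<Psi> has weight \<open>k + 1\<close> as lattice functions, so
  \<open>k\<close> drops out of the quotient.\<close>

lemma Phi_over_Psi_mobius:
  assumes Z: "elliptic_zeta k S \<Z>" and \<tau>: "\<tau> \<in> upper_half_plane - S"
  shows "Phi_over_Psi \<Z> (mobius a b c d \<tau>) = (factor \<tau>)\<^sup>2 * Phi_over_Psi \<Z> \<tau>"
proof -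
  define u where "u = factor \<tau>"
  define m where "m = mobius a b c d \<tau>"
  have pos: "Im \<tau> > 0" "Im m > 0"
    using \<tau> Im_mobius_pos by (auto simp: m_def)
  have u: "u \<noteq> 0"
    using factor_nonzero pos by (simp add: u_def)
  interpret complex_lattice 1 m
    by (rule complex_lattice_1) fact
  have "exceptional_set S"
    using Z by (simp add: elliptic_zeta_def)
  \<comment> \<open>Invariance of \<open>S\<close> is applied to the inverse matrix: an exceptional
    image would make \<tau> exceptional.\<close>
  have mS: "m \<in> upper_half_plane - S"
  proof -
    have "d * a - (- b) * (- c) = 1"
      using det by (simp add: mult.commute)
    then have "mobius d (- b) (- c) a m \<in> S" if "m \<in> S"
      using \<open>exceptional_set S\<close> that unfolding exceptional_set_def by blast
    then show ?thesis
      using mobius_inverse[OF pos(1)] \<tau> pos(2) by (auto simp: m_def)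
  qed
  have \<Lambda>: "lattice_of \<tau> = (*) u ` lattice_of m"
    using lattice_of_mobius[OF pos(1)] by (simp add: u_def m_def)
  define \<phi> where "\<phi> = Phi \<Z> (lattice_of \<tau>)"
  define \<psi> where "\<psi> = Psi \<Z> (lattice_of \<tau>)"
  have per: "quasi_period (\<Z> (lattice_of m)) \<omega> =
      (\<phi> * u / u powi k) * \<omega> + (\<psi> / (u * u powi k)) * weierstrass_eta (lattice_of m) \<omega>"
    if \<omega>: "\<omega> \<in> lattice_of m" for \<omega>
  proof -
    note Zm = elliptic_zetaD[OF Z mS]
    have "quasi_period (\<Z> (lattice_of \<tau>)) (u * \<omega>) = u powi k * quasi_period (\<Z> (lattice_of m)) \<omega>"
      unfolding \<Lambda> using u Zm(1,3) is_quasi_period_quasi_period[OF Zm(1) Zm(2)[OF \<omega>]]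
      by (intro quasi_period_scale) auto
    moreover have "quasi_period (\<Z> (lattice_of \<tau>)) (u * \<omega>) =
        \<phi> * (u * \<omega>) + \<psi> * weierstrass_eta (lattice_of \<tau>) (u * \<omega>)"
      unfolding \<phi>_def \<psi>_def using elliptic_zetaD(1,2)[OF Z \<tau>] \<omega>
      by (intro quasi_period_eq_Phi_Psi pos) (auto simp: \<Lambda>)
    moreover have "weierstrass_eta (lattice_of \<tau>) (u * \<omega>) = inverse u * weierstrass_eta (lattice_of m) \<omega>"
      unfolding \<Lambda> using u \<omega> by (rule weierstrass_eta_scale)
    ultimately have "u powi k * quasi_period (\<Z> (lattice_of m)) \<omega> =
        \<phi> * (u * \<omega>) + \<psi> * (inverse u * weierstrass_eta (lattice_of m) \<omega>)"
      by simp
    then show ?thesis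
      using u by (simp add: divide_simps power_int_eq_0_iff) (simp add: algebra_simps)
  qed
  have "Phi \<Z> (lattice_of m) = \<phi> * u / u powi k" "Psi \<Z> (lattice_of m) = \<psi> / (u * u powi k)"
    using Phi_Psi_eqI[OF pos(2), of \<Z>, OF per] by blast+
  then have "Phi_over_Psi \<Z> m = u\<^sup>2 * (\<phi> / \<psi>)"
    using u by (simp add: Phi_over_Psi_def power2_eq_square power_int_eq_0_iff)
  then show ?thesis
    by (simp add: Phi_over_Psi_def m_def u_def \<phi>_def \<psi>_def)
qed

text \<open>At points of \<open>S\<close> the raw quotient is arbitrary, but the law off
  \<open>S\<close> holds nearby, and \<open>remove_sings\<close> commutes with the Moebius map and
  with the nonvanishing automorphy factor.\<close>

lemma remove_sings_Phi_over_Psi_mobius: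
  assumes Z: "elliptic_zeta k S \<Z>" and \<tau>: "Im \<tau> > 0"
  shows "remove_sings (Phi_over_Psi \<Z>) (mobius a b c d \<tau>) =
    (factor \<tau>)\<^sup>2 * remove_sings (Phi_over_Psi \<Z>) \<tau>"
proof -
  have "remove_sings (Phi_over_Psi \<Z>) (mobius a b c d \<tau>) =
      remove_sings (Phi_over_Psi \<Z> \<circ> mobius a b c d) \<tau>"
    using remove_sings_compose[OF filtermap_mobius_at[OF \<tau>]] by simp
  also have "\<dots> = remove_sings (\<lambda>w. (factor w)\<^sup>2 * Phi_over_Psi \<Z> w) \<tau>"
  proof (rule remove_sings_cong)
    have "\<forall>\<^sub>F w in at \<tau>. w \<in> upper_half_plane - S"
      using Z \<tau> by (intro exceptional_set_eventually_notin) (auto simp: elliptic_zeta_def)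
    then show "\<forall>\<^sub>F w in at \<tau>. (Phi_over_Psi \<Z> \<circ> mobius a b c d) w = (factor w)\<^sup>2 * Phi_over_Psi \<Z> w"
      by eventually_elim (use Phi_over_Psi_mobius[OF Z] in simp)
  qed simp
  also have "\<dots> = (factor \<tau>)\<^sup>2 * remove_sings (Phi_over_Psi \<Z>) \<tau>"
  proof (rule remove_sings_mult)
    show "isCont (\<lambda>w. (factor w)\<^sup>2) \<tau>"
      unfolding factor_def by (intro continuous_intros)
  qed (use factor_nonzero[OF \<tau>] in simp)
  finally show ?thesis .
qed

end

lemma nicely_meromorphic_on_cong_open:
  assumes "open A" "\<And>z. z \<in> A \<Longrightarrow> f z = g z" "f nicely_meromorphic_on A"
  shows "g nicely_meromorphic_on A"
proof -
  have ev: "\<forall>\<^sub>F w in at z. f w = g w" if "z \<in> A" for z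
    using eventually_at_in_open'[OF assms(1) that] by eventually_elim (rule assms(2))
  have "g meromorphic_on A"
    using assms(3) meromorphic_on_cong[of A f g] ev unfolding nicely_meromorphic_on_def by blast
  moreover have "is_pole g z \<and> g z = 0 \<or> g \<midarrow>z\<rightarrow> g z" if z: "z \<in> A" for z
    using assms(3) z is_pole_cong[OF ev[OF z] refl] tendsto_cong[OF ev[OF z]] assms(2)[OF z]
    unfolding nicely_meromorphic_on_def by auto
  ultimately show ?thesis
    by (simp add: nicely_meromorphic_on_def)
qed

lemma modular_quotient_in_weight2:
  assumes Z: "elliptic_zeta k S \<Z>"
  shows "modular_quotient \<Z> \<in> weight2_meromorphic_modular_forms"
proof -
  have "modular_quotient \<Z> nicely_meromorphic_on upper_half_plane"
  proof (rule nicely_meromorphic_on_cong_open)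
    show "remove_sings (Phi_over_Psi \<Z>) nicely_meromorphic_on upper_half_plane"
      by (intro remove_sings_nicely_meromorphic Phi_over_Psi_meromorphic[OF Z])
  qed (simp_all add: modular_quotient_def)
  moreover have "modular_quotient \<Z> (mobius a b c d \<tau>) =
      (of_int c * \<tau> + of_int d)\<^sup>2 * modular_quotient \<Z> \<tau>"
    if "a * d - b * c = 1" "\<tau> \<in> upper_half_plane" for a b c d \<tau>
  proof -
    interpret modular_matrix a b c d
      by unfold_locales (rule that(1))
    show ?thesis
      using that(2) Im_mobius_pos remove_sings_Phi_over_Psi_mobius[OF Z]
      by (simp add: modular_quotient_def factor_def)
  qed
  ultimately show ?thesis
    by (simp add: weight2_meromorphic_modular_forms_def modular_quotient_def)
qed

section \<open>Surjectivity\<close>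

text \<open>Two bases of one lattice are related by an integer matrix with integer inverse, so its
  determinant is 1 or \<open>- 1\<close>; both bases being positively oriented leaves only
  1.\<close>

lemma lattice_of_scaled_eqE:
  assumes "Im \<tau> > 0" "Im \<tau>' > 0" "\<gamma> \<noteq> 0" and eq: "(*) \<gamma> ` lattice_of \<tau>' = lattice_of \<tau>"
  obtains a b c d where "a * d - b * c = 1" "\<gamma> = of_int c * \<tau> + of_int d" "\<tau>' = mobius a b c d \<tau>"
proof -
  have "\<gamma> * 1 \<in> lattice_of \<tau>" "\<gamma> * \<tau>' \<in> lattice_of \<tau>"
    unfolding eq[symmetric] by (intro imageI; simp)+
  then obtain c d a b where cd: "\<gamma> = of_int d * 1 + of_int c * \<tau>" and ab: "\<gamma> * \<tau>' = of_int b * 1 + of_int a * \<tau>"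
    by (elim lattice_genE) auto
  have "1 \<in> (*) \<gamma> ` lattice_of \<tau>'" "\<tau> \<in> (*) \<gamma> ` lattice_of \<tau>'"
    unfolding eq by simp_all
  then obtain p q r s where pq: "1 = \<gamma> * (of_int p * 1 + of_int q * \<tau>')" and rs: "\<tau> = \<gamma> * (of_int r * 1 + of_int s * \<tau>')"
    unfolding lattice_gen_def by blast
  interpret complex_lattice 1 \<tau>
    by (rule complex_lattice_1) fact
  have coeff: "m = m' \<and> n = n'" if "of_int m + of_int n * \<tau> = of_int m' + of_int n' * \<tau>" for m n m' n'
    using real_combination_eq_iff[of "of_int m" "of_int n" "of_int m'" "of_int n'"] that by simp
  have expand: "of_int (m * d + n * b) + of_int (m * c + n * a) * \<tau> = \<gamma> * (of_int m * 1 + of_int n * \<tau>')" for m n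
  proof -
    have "\<gamma> * (of_int m * 1 + of_int n * \<tau>') = of_int m * \<gamma> + of_int n * (\<gamma> * \<tau>')"
      by (simp add: algebra_simps)
    then show ?thesis
      unfolding ab unfolding cd by (simp add: algebra_simps)
  qed
  have "of_int (p * d + q * b) + of_int (p * c + q * a) * \<tau> = of_int 1 + of_int 0 * \<tau>"
    unfolding expand using pq by simp
  then have 1: "p * d + q * b = 1" "p * c + q * a = 0"
    using coeff by blast+
  have "of_int (r * d + s * b) + of_int (r * c + s * a) * \<tau> = of_int 0 + of_int 1 * \<tau>"
    unfolding expand using rs by simp
  then have 2: "r * d + s * b = 0" "r * c + s * a = 1"
    using coeff by blast+
  \<comment> \<open>The relations above say that the matrix of \<open>p\<close>, \<open>q\<close>,
    \<open>r\<close>, \<open>s\<close> inverts the one with rows \<open>d\<close>, \<open>c\<close>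
    and \<open>b\<close>, \<open>a\<close>.\<close>
  have "(p * s - q * r) * (a * d - b * c) = 1"
    using 1 2 by algebra
  then have pm: "a * d - b * c = 1 \<or> a * d - b * c = - 1"
    by (metis mult.commute zmult_eq_1_iff)
  have \<tau>': "\<tau>' = (of_int a * \<tau> + of_int b) / \<gamma>"
    using ab \<open>\<gamma> \<noteq> 0\<close> by (simp add: field_simps)
  have "Im ((of_int a * \<tau> + of_int b) * cnj \<gamma>) = of_int (a * d - b * c) * Im \<tau>"
    by (simp add: cd algebra_simps)
  moreover have "Im \<tau>' = Im ((of_int a * \<tau> + of_int b) * cnj \<gamma>) / (norm \<gamma>)\<^sup>2"
    unfolding \<tau>' complex_div_cnj[of _ \<gamma>] by (simp only: Im_divide_of_real)
  ultimately have pos: "of_int (a * d - b * c) * Im \<tau> / (norm \<gamma>)\<^sup>2 > 0"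
    using assms(2) by simp
  have "a * d - b * c \<noteq> - 1"
  proof
    assume "a * d - b * c = - 1"
    then show False
      using pos assms(1) by (auto simp: divide_less_0_iff simp del: of_int_diff of_int_mult)
  qed
  then have "a * d - b * c = 1"
    using pm by blast
  moreover have "\<gamma> = of_int c * \<tau> + of_int d"
    using cd by simp
  moreover from this have "\<tau>' = mobius a b c d \<tau>"
    using \<tau>' by (simp add: mobius_def)
  ultimately show ?thesis
    by (rule that)
qed

text \<open>
  The lattice function of weight \<open>- 2\<close> that extends \<open>\<Lambda>\<^sub>\<tau> \<mapsto> f \<tau>\<close>; the description is definite
  because \<open>f\<close> is modular. At exceptional lattices it inherits the dummy value \<open>0\<close> of \<open>f\<close>.
\<close>

definition lattice_fun :: "(complex \<Rightarrow> complex) \<Rightarrow> complex set \<Rightarrow> complex" where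
  "lattice_fun f \<Lambda> =
     (THE x. \<exists>\<alpha> \<tau>. \<alpha> \<noteq> 0 \<and> Im \<tau> > 0 \<and> \<Lambda> = (*) \<alpha> ` lattice_of \<tau> \<and> x = f \<tau> / \<alpha>\<^sup>2)"

definition modular_zeta :: "(complex \<Rightarrow> complex) \<Rightarrow> complex set \<Rightarrow> complex \<Rightarrow> complex" where
  "modular_zeta f \<Lambda> z = (if z \<in> \<Lambda> then 0 else lattice_fun f \<Lambda> * z + weierstrass_zeta \<Lambda> z)"

context
  fixes f :: "complex \<Rightarrow> complex"
  assumes f: "f \<in> weight2_meromorphic_modular_forms"
begin

lemma weight2_mobius:
  assumes "a * d - b * c = 1" "Im \<tau> > 0"
  shows "f (mobius a b c d \<tau>) = (of_int c * \<tau> + of_int d)\<^sup>2 * f \<tau>"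
  using f assms by (simp add: weight2_meromorphic_modular_forms_def)

text \<open>Two representations of a lattice differ by an automorphy factor
  \<open>\<gamma> = \<beta> / \<alpha>\<close>, and weight 2 is exactly what makes the two candidate
  values agree.\<close>

lemma lattice_fun_scaled:
  assumes "\<alpha> \<noteq> 0" "Im \<tau> > 0"
  shows "lattice_fun f ((*) \<alpha> ` lattice_of \<tau>) = f \<tau> / \<alpha>\<^sup>2"
  unfolding lattice_fun_def
proof (rule the_equality)
  fix x assume "\<exists>\<beta> \<tau>'. \<beta> \<noteq> 0 \<and> Im \<tau>' > 0 \<and> (*) \<alpha> ` lattice_of \<tau> = (*) \<beta> ` lattice_of \<tau>' \<and> x = f \<tau>' / \<beta>\<^sup>2"
  then obtain \<beta> \<tau>' where \<beta>: "\<beta> \<noteq> 0" "Im \<tau>' > 0" "(*) \<alpha> ` lattice_of \<tau> = (*) \<beta> ` lattice_of \<tau>'" "x = f \<tau>' / \<beta>\<^sup>2"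
    by blast
  define \<gamma> where "\<gamma> = \<beta> / \<alpha>"
  have \<gamma>: "\<gamma> \<noteq> 0" "\<beta> = \<alpha> * \<gamma>"
    using \<beta>(1) assms(1) by (simp_all add: \<gamma>_def)
  have "(*) (inverse \<alpha>) ` (*) \<alpha> ` lattice_of \<tau> = (*) (inverse \<alpha>) ` (*) \<beta> ` lattice_of \<tau>'"
    using \<beta>(3) by simp
  moreover have "(*) (inverse \<alpha>) \<circ> (*) \<alpha> = id" "(*) (inverse \<alpha>) \<circ> (*) \<beta> = (*) \<gamma>"
    using assms(1) by (auto simp: fun_eq_iff \<gamma>(2))
  ultimately have "(*) \<gamma> ` lattice_of \<tau>' = lattice_of \<tau>"
    by (metis image_comp image_id id_apply)
  then obtain a b c d where abcd: "a * d - b * c = 1" "\<gamma> = of_int c * \<tau> + of_int d" "\<tau>' = mobius a b c d \<tau>"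
    using lattice_of_scaled_eqE[OF assms(2) \<beta>(2) \<gamma>(1)] by metis
  then have "f \<tau>' = \<gamma>\<^sup>2 * f \<tau>"
    using weight2_mobius[OF abcd(1) assms(2)] by simp
  then show "x = f \<tau> / \<alpha>\<^sup>2"
    using \<gamma> by (simp add: \<beta>(4) power_mult_distrib)
qed (use assms in blast)

lemma lattice_fun_lattice_of: "Im \<tau> > 0 \<Longrightarrow> lattice_fun f (lattice_of \<tau>) = f \<tau>"
  using lattice_fun_scaled[of 1 \<tau>] by simp

lemma quasi_period_modular_zeta:
  assumes "Im \<tau> > 0" "\<omega> \<in> lattice_of \<tau>"
  shows "quasi_period (modular_zeta f (lattice_of \<tau>)) \<omega> = f \<tau> * \<omega> + weierstrass_eta (lattice_of \<tau>) \<omega>"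
proof -
  interpret complex_lattice 1 \<tau>
    by (rule complex_lattice_1) fact
  have eq: "modular_zeta f L = (\<lambda>z. if z \<in> L then 0 else f \<tau> * z + weierstrass_zeta L z)"
    using assms(1) by (simp add: modular_zeta_def fun_eq_iff lattice_fun_lattice_of)
  show ?thesis
    unfolding eq using nicely_meromorphic_linear_plus_zeta[of "f \<tau>"] quasi_period_linear_plus_zeta[OF assms(2)]
    by (intro quasi_period_eqI_meromorphic) (auto simp: nicely_meromorphic_on_def)
qed

lemma f_meromorphic: "f meromorphic_on upper_half_plane"
  and f_nicely_meromorphic: "f nicely_meromorphic_on upper_half_plane"
  using f by (auto simp: weight2_meromorphic_modular_forms_def nicely_meromorphic_on_def)

lemma is_pole_mobius:
  assumes "a * d - b * c = 1" "Im \<tau> > 0" "is_pole f \<tau>"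
  shows "is_pole f (mobius a b c d \<tau>)"
proof -
  interpret modular_matrix a b c d
    by unfold_locales (rule assms(1))
  have "((\<lambda>w. (factor w)\<^sup>2) \<longlongrightarrow> (factor \<tau>)\<^sup>2) (at \<tau>)"
    unfolding factor_def by (intro tendsto_intros)
  then have "LIM w at \<tau>. (factor w)\<^sup>2 * f w :> at_infinity"
    by (rule tendsto_mult_filterlim_at_infinity)
       (use factor_nonzero[OF assms(2)] assms(3) in \<open>auto simp: is_pole_def\<close>)
  then have "is_pole (\<lambda>w. (factor w)\<^sup>2 * f w) \<tau>"
    by (simp add: is_pole_def)
  moreover have "\<forall>\<^sub>F w in at \<tau>. w \<in> upper_half_plane"
    using assms(2) by (intro eventually_at_in_open') auto
  then have "\<forall>\<^sub>F w in at \<tau>. (factor w)\<^sup>2 * f w = (f \<circ> mobius a b c d) w"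
    by eventually_elim (simp add: weight2_mobius[OF assms(1)] factor_def)
  ultimately have "is_pole (f \<circ> mobius a b c d) \<tau>"
    by (rule is_pole_transform) simp
  then show ?thesis
    using is_pole_compose_iff[OF filtermap_mobius_at[OF assms(2)]] by blast
qed

text \<open>At a pole of \<open>f\<close> the dummy value 0 still gives a quasi-periodic function,
  but its quasi-periods do not depend continuously on \<tau> there. Holomorphy in \<tau> therefore
  forces the poles into the exceptional set.\<close>

lemma exceptional_set_poles: "exceptional_set {\<tau> \<in> upper_half_plane. is_pole f \<tau>}"
proof -
  define S where "S = {\<tau> \<in> upper_half_plane. is_pole f \<tau>}"
  have ev: "\<forall>\<^sub>F w in at \<tau>. w \<notin> S" if "\<tau> \<in> upper_half_plane" for \<tau>
    using eventually_not_pole_meromorphic[OF f_meromorphic that] by eventually_elim (simp add: S_def)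
  have "S sparse_in upper_half_plane"
    using ev by (simp add: sparse_in_eventually_iff)
  then have "closedin (top_of_set upper_half_plane) (upper_half_plane \<inter> S)"
    by (rule sparse_imp_closedin_pts)
  also have "upper_half_plane \<inter> S = S"
    by (auto simp: S_def)
  finally have "closedin (top_of_set upper_half_plane) S" .
  moreover have "discrete S"
    using ev by (intro discreteI) (auto simp: isolated_in_altdef S_def)
  moreover have "mobius a b c d \<tau> \<in> S" if "a * d - b * c = 1" "\<tau> \<in> S" for a b c d \<tau>
    using that is_pole_mobius modular_matrix.Im_mobius_pos[OF modular_matrix.intro]
    by (auto simp: S_def)
  ultimately have "exceptional_set S"
    by (simp add: exceptional_set_def)
  then show ?thesis
    by (simp add: S_def)
qed

lemma elliptic_zeta_modular_zeta:
  "elliptic_zeta (- 1) {\<tau> \<in> upper_half_plane. is_pole f \<tau>} (modular_zeta f)"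
proof -
  define S where "S = {\<tau> \<in> upper_half_plane. is_pole f \<tau>}"
  have lat: "modular_zeta f \<Lambda> nicely_meromorphic_on UNIV \<and>
        (\<forall>\<omega>\<in>\<Lambda>. \<exists>h. is_quasi_period (modular_zeta f \<Lambda>) \<omega> h) \<and>
        (\<forall>\<beta> z. \<beta> \<noteq> 0 \<longrightarrow> modular_zeta f ((*) \<beta> ` \<Lambda>) (\<beta> * z) = \<beta> powi - 1 * modular_zeta f \<Lambda> z)"
    if reg: "\<Lambda> \<in> regular_lattices S" for \<Lambda>
  proof -
    obtain \<alpha> \<tau> where \<alpha>: "\<alpha> \<noteq> 0" "Im \<tau> > 0" "\<Lambda> = (*) \<alpha> ` lattice_of \<tau>"
      using reg unfolding regular_lattices_def by auto
    interpret complex_lattice \<alpha> "\<alpha> * \<tau>"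
      using \<alpha> by unfold_locales simp
    have \<Lambda>: "\<Lambda> = L"
      by (simp add: \<alpha>(3) scaled_lattice_of)
    have eq: "modular_zeta f L = (\<lambda>z. if z \<in> L then 0 else lattice_fun f L * z + weierstrass_zeta L z)"
      by (simp add: modular_zeta_def fun_eq_iff)
    have "modular_zeta f ((*) \<beta> ` \<Lambda>) (\<beta> * z) = \<beta> powi - 1 * modular_zeta f \<Lambda> z" if \<beta>: "\<beta> \<noteq> 0" for \<beta> z
    proof -
      have "(*) \<beta> ` \<Lambda> = (*) (\<beta> * \<alpha>) ` lattice_of \<tau>"
        by (simp add: \<alpha>(3) image_comp o_def mult.assoc)
      then have "lattice_fun f ((*) \<beta> ` \<Lambda>) = f \<tau> / (\<beta> * \<alpha>)\<^sup>2"
        using lattice_fun_scaled[of "\<beta> * \<alpha>" \<tau>] \<alpha> \<beta> by simp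
      moreover have "lattice_fun f \<Lambda> = f \<tau> / \<alpha>\<^sup>2"
        unfolding \<alpha>(3) using \<alpha>(1,2) by (rule lattice_fun_scaled)
      ultimately have "lattice_fun f ((*) \<beta> ` \<Lambda>) = lattice_fun f \<Lambda> / \<beta>\<^sup>2"
        by (simp add: power_mult_distrib)
      moreover have "\<beta> * z \<in> (*) \<beta> ` \<Lambda> \<longleftrightarrow> z \<in> \<Lambda>"
        using \<beta> by auto
      ultimately show ?thesis
        using \<beta> weierstrass_zeta_scale[OF \<beta>, of \<Lambda> z]
        by (simp add: modular_zeta_def power_int_minus power2_eq_square distrib_left divide_inverse)
    qed
    then show ?thesis
      using nicely_meromorphic_linear_plus_zeta quasi_period_linear_plus_zeta unfolding \<Lambda> eq by blast
  qed
  have "f analytic_on {\<tau>}" if "\<tau> \<in> upper_half_plane - S" for \<tau>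
    using that by (intro nicely_meromorphic_on_imp_analytic_at[OF f_nicely_meromorphic]) (auto simp: S_def)
  then have f_hol: "f holomorphic_on upper_half_plane - S"
    by (meson analytic_imp_holomorphic analytic_on_analytic_at)
  \<comment> \<open>One argument serves both periods, with \<open>w\<close> being \<tau> or
    constantly 1.\<close>
  have per: "(\<lambda>\<tau>. quasi_period (modular_zeta f (lattice_of \<tau>)) (w \<tau>)) holomorphic_on (upper_half_plane - S) \<and>
       (\<lambda>\<tau>. quasi_period (modular_zeta f (lattice_of \<tau>)) (w \<tau>)) meromorphic_on upper_half_plane"
    if w: "\<And>\<tau>. w \<tau> \<in> lattice_of \<tau>" and w_hol: "w holomorphic_on upper_half_plane"
      and \<eta>: "(\<lambda>\<tau>. weierstrass_eta (lattice_of \<tau>) (w \<tau>)) holomorphic_on upper_half_plane" for w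
  proof
    have eq: "f \<tau> * w \<tau> + weierstrass_eta (lattice_of \<tau>) (w \<tau>) =
        quasi_period (modular_zeta f (lattice_of \<tau>)) (w \<tau>)" if "Im \<tau> > 0" for \<tau>
      using quasi_period_modular_zeta[OF that w] by simp
    have "(\<lambda>\<tau>. f \<tau> * w \<tau> + weierstrass_eta (lattice_of \<tau>) (w \<tau>)) holomorphic_on (upper_half_plane - S)"
      by (intro holomorphic_intros f_hol holomorphic_on_subset[OF w_hol] holomorphic_on_subset[OF \<eta>]) auto
    then show "(\<lambda>\<tau>. quasi_period (modular_zeta f (lattice_of \<tau>)) (w \<tau>)) holomorphic_on (upper_half_plane - S)"
      by (rule holomorphic_transform) (simp add: eq)
    have "(\<lambda>\<tau>. f \<tau> * w \<tau> + weierstrass_eta (lattice_of \<tau>) (w \<tau>)) meromorphic_on upper_half_plane"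
      using w_hol \<eta> by (intro meromorphic_intros f_meromorphic analytic_on_imp_meromorphic_on) (simp_all add: analytic_on_open)
    also have "?this \<longleftrightarrow> (\<lambda>\<tau>. quasi_period (modular_zeta f (lattice_of \<tau>)) (w \<tau>)) meromorphic_on upper_half_plane"
    proof (rule meromorphic_on_cong)
      fix \<tau> assume "\<tau> \<in> upper_half_plane"
      then have "\<forall>\<^sub>F w in at \<tau>. w \<in> upper_half_plane"
        by (intro eventually_at_in_open') auto
      then show "\<forall>\<^sub>F \<tau> in at \<tau>. f \<tau> * w \<tau> + weierstrass_eta (lattice_of \<tau>) (w \<tau>) =
          quasi_period (modular_zeta f (lattice_of \<tau>)) (w \<tau>)"
        by eventually_elim (simp add: eq)
    qed simp
    finally show "(\<lambda>\<tau>. quasi_period (modular_zeta f (lattice_of \<tau>)) (w \<tau>)) meromorphic_on upper_half_plane" .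
  qed
  have "elliptic_zeta (- 1) S (modular_zeta f)"
    unfolding elliptic_zeta_def
    using exceptional_set_poles lat per[of "\<lambda>\<tau>. \<tau>"] per[of "\<lambda>_. 1"] weierstrass_eta_holomorphic
    by (auto simp: S_def intro: holomorphic_intros)
  then show ?thesis
    by (simp add: S_def)
qed

lemma Phi_Psi_modular_zeta:
  assumes "Im \<tau> > 0"
  shows "Phi (modular_zeta f) (lattice_of \<tau>) = f \<tau>" "Psi (modular_zeta f) (lattice_of \<tau>) = 1"
  using assms by (auto intro!: Phi_Psi_eqI simp: quasi_period_modular_zeta)

lemma modular_zeta_nondegenerate: "modular_zeta f \<in> nondegenerate_elliptic_zetas"
proof -
  define S where "S = {\<tau> \<in> upper_half_plane. is_pole f \<tau>}"
  obtain \<tau> where \<tau>: "\<tau> \<in> upper_half_plane - S"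
    using eventually_happens'[OF _ exceptional_set_eventually_notin[OF exceptional_set_poles, of \<i>]]
    by (auto simp: S_def)
  then have "Psi (modular_zeta f) (lattice_of \<tau>) \<noteq> 0"
    by (simp add: Phi_Psi_modular_zeta)
  then show ?thesis
    unfolding nondegenerate_elliptic_zetas_def using elliptic_zeta_modular_zeta \<tau> S_def by blast
qed

text \<open>Equality holds at every point: \<open>remove_sings\<close> fixes a function in normal
  form, poles included, and extensionality settles the values outside the half-plane.\<close>

lemma modular_quotient_modular_zeta: "modular_quotient (modular_zeta f) = f"
proof
  fix \<tau>
  show "modular_quotient (modular_zeta f) \<tau> = f \<tau>"
  proof (cases "Im \<tau> > 0")
    case True
    then have "\<forall>\<^sub>F w in at \<tau>. w \<in> upper_half_plane"
      by (intro eventually_at_in_open') auto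
    then have "\<forall>\<^sub>F w in at \<tau>. Phi_over_Psi (modular_zeta f) w = f w"
      by eventually_elim (simp add: Phi_over_Psi_def Phi_Psi_modular_zeta)
    then have "remove_sings (Phi_over_Psi (modular_zeta f)) \<tau> = remove_sings f \<tau>"
      by (rule remove_sings_cong) simp
    also have "is_pole f \<tau> \<and> f \<tau> = 0 \<or> f \<midarrow>\<tau>\<rightarrow> f \<tau>"
      using f_nicely_meromorphic True unfolding nicely_meromorphic_on_def by simp
    then have "remove_sings f \<tau> = f \<tau>"
      by auto
    finally show ?thesis
      using True by (simp add: modular_quotient_def)
  next
    case False
    then show ?thesis
      using f by (simp add: modular_quotient_def weight2_meromorphic_modular_forms_def extensional_def)
  qed
qed

end

theorem theorem4p1:
  shows "(\<forall>\<Z>\<in>nondegenerate_elliptic_zetas. Phi_over_Psi \<Z> meromorphic_on upper_half_plane) \<and>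
    modular_quotient \<in> nondegenerate_elliptic_zetas \<rightarrow> weight2_meromorphic_modular_forms \<and>
    modular_quotient ` nondegenerate_elliptic_zetas = weight2_meromorphic_modular_forms"
proof (intro conjI ballI)
  fix \<Z> assume "\<Z> \<in> nondegenerate_elliptic_zetas"
  then show "Phi_over_Psi \<Z> meromorphic_on upper_half_plane"
    using Phi_over_Psi_meromorphic by (auto simp: nondegenerate_elliptic_zetas_def)
next
  show *: "modular_quotient \<in> nondegenerate_elliptic_zetas \<rightarrow> weight2_meromorphic_modular_forms"
    using modular_quotient_in_weight2 by (auto simp: nondegenerate_elliptic_zetas_def)
  show "modular_quotient ` nondegenerate_elliptic_zetas = weight2_meromorphic_modular_forms"
  proof
    show "weight2_meromorphic_modular_forms \<subseteq> modular_quotient ` nondegenerate_elliptic_zetas"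
      using modular_quotient_modular_zeta modular_zeta_nondegenerate by (metis image_eqI subsetI)
  qed (use * in auto)
qed

end
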